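(* Let $A,B\in\mathcal{L}(H)$ be such that both $\overline{\mathcal{R}(A)}$ and $\overline{\mathcal{R}(B)}$ are orthogonally complemented. Then the following statements are valid: (i) if $A,B\in\mathcal{L}(H)_+$ and $AB=BA$, then $AB=P_{\overline{\mathcal{R}(A)}}P_{\overline{\mathcal{R}(B)}}|AB|$ is the polar decomposition of $AB$; (ii) if $A,B\in\mathcal{L}(H)_{sa}$ and there exist two projections $p,q\in\mathcal{L}(H)$ such that $AB=pq|AB|$ is the polar decomposition of $AB$, then $AB=BA$.
   Context: $\mathfrak{A}$ is a $C^*$-algebra, $H$ is a (right) Hilbert $\mathfrak{A}$-module, and $\mathcal{L}(H)$ is the $C^*$-algebra of adjointable operators on $H$; $\mathcal{L}(H)_{sa}$ and $\mathcal{L}(H)_+$ are its sets of self-adjoint and positive elements. For $T\in\mathcal{L}(H)$, $|T|=(T^*T)^{1/2}$, and $\mathcal{R}(T)$ is the range of $T$. A closed submodule $M\subseteq H$ is orthogonally complemented if $H=M\dotplus M^\perp$; then $P_M$ denotes the projection from $H$ onto $M$. An element $W\in\mathcal{L}(H)$ is a partial isometry if $W^*W$ is a projection. "$T=U|T|$ is the polar decomposition of $T$" means: $U\in\mathcal{L}(H)$ is a partial isometry, $T=U|T|$, $\overline{\mathcal{R}(T^* )}$ is orthogonally complemented, and $U^*U=P_{\overline{\mathcal{R}(T^* )}}$. (Such a $U$ is unique when it exists, and it exists if and only if both $\overline{\mathcal{R}(T^* )}$ and $\overline{\mathcal{R}(T)}$ are orthogonally complemented.) *)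

theory Defs
  imports "HOL-Analysis.Analysis"
begin

section \<open>C*-algebras\<close>

class complex_vector = real_vector +
  fixes scaleC :: "complex \<Rightarrow> 'a \<Rightarrow> 'a"  (infixr "*\<^sub>C" 75)
  assumes scaleC_add_right: "c *\<^sub>C (x + y) = c *\<^sub>C x + c *\<^sub>C y"
    and scaleC_add_left: "(c + d) *\<^sub>C x = c *\<^sub>C x + d *\<^sub>C x"
    and scaleC_scaleC: "c *\<^sub>C d *\<^sub>C x = (c * d) *\<^sub>C x"
    and scaleR_scaleC: "r *\<^sub>R x = complex_of_real r *\<^sub>C x"

class cstar_algebra = complex_vector + banach + real_normed_algebra +
  fixes star :: "'a \<Rightarrow> 'a"
  assumes norm_scaleC: "norm (c *\<^sub>C x) = cmod c * norm x"
    and mult_scaleC_left: "(c *\<^sub>C x) * y = c *\<^sub>C (x * y)"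
    and mult_scaleC_right: "x * (c *\<^sub>C y) = c *\<^sub>C (x * y)"
    and star_star: "star (star x) = x"
    and star_add: "star (x + y) = star x + star y"
    and star_scaleC: "star (c *\<^sub>C x) = cnj c *\<^sub>C star x"
    and star_mult: "star (x * y) = star y * star x"
    and cstar_identity: "norm (star x * x) = (norm x)\<^sup>2"

text \<open>
  Since the algebra need not have a unit, the spectrum is taken in the unitization, whose
  elements are the pairs \<open>(a, \<mu>)\<close>, thought of as \<open>a + \<mu> 1\<close>. If the algebra
  already has a unit, this only adds the point 0 to the usual spectrum and so does not
  affect positivity.
\<close>

fun unitization_mult ::
    "'a::cstar_algebra \<times> complex \<Rightarrow> 'a \<times> complex \<Rightarrow> 'a \<times> complex" where
  "unitization_mult (a, \<mu>) (b, \<nu>) = (a * b + \<mu> *\<^sub>C b + \<nu> *\<^sub>C a, \<mu> * \<nu>)"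

definition cstar_spectrum :: "'a::cstar_algebra \<Rightarrow> complex set" where
  "cstar_spectrum a = {\<zeta>. \<not> (\<exists>u. unitization_mult (- a, \<zeta>) u = (0, 1)
                              \<and> unitization_mult u (- a, \<zeta>) = (0, 1))}"

definition cstar_positive :: "'a::cstar_algebra \<Rightarrow> bool" where
  "cstar_positive a \<longleftrightarrow> star a = a \<and> cstar_spectrum a \<subseteq> \<real>\<^sub>\<ge>\<^sub>0"


section \<open>Hilbert C*-modules\<close>

text \<open>
  Right modules \<open>H\<close>, with \<open>act x a\<close> for \<open>x a\<close>; the inner product \<open>ip\<close> is linear in
  its second argument. Completeness with respect to the norm induced by \<open>ip\<close> comes from
  the class \<open>banach\<close> together with \<open>norm_eq\<close>.
\<close>

locale hilbert_module =
  fixes act :: "'h::{complex_vector, banach} \<Rightarrow> 'a::cstar_algebra \<Rightarrow> 'h"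
    and ip :: "'h \<Rightarrow> 'h \<Rightarrow> 'a"
  assumes act_add_left: "act (x + y) a = act x a + act y a"
    and act_add_right: "act x (a + b) = act x a + act x b"
    and act_mult: "act x (a * b) = act (act x a) b"
    and act_scaleC_left: "act (c *\<^sub>C x) a = c *\<^sub>C act x a"
    and act_scaleC_right: "act x (c *\<^sub>C a) = c *\<^sub>C act x a"
    and ip_add_right: "ip x (y + z) = ip x y + ip x z"
    and ip_scaleC_right: "ip x (c *\<^sub>C y) = c *\<^sub>C ip x y"
    and ip_act_right: "ip x (act y a) = ip x y * a"
    and star_ip: "star (ip x y) = ip y x"
    and ip_positive: "cstar_positive (ip x x)"
    and ip_definite: "ip x x = 0 \<Longrightarrow> x = 0"
    and norm_eq: "norm x = sqrt (norm (ip x x))"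


section \<open>Adjointable operators\<close>

text \<open>
  Neither linearity nor boundedness is required in \<open>adjointables\<close>, the algebra of adjointable
  operators: as usual, both are consequences of the existence of an adjoint.
\<close>

definition is_adjoint :: "('h \<Rightarrow> 'h \<Rightarrow> 'a) \<Rightarrow> ('h \<Rightarrow> 'h) \<Rightarrow> ('h \<Rightarrow> 'h) \<Rightarrow> bool" where
  "is_adjoint ip T S \<longleftrightarrow> (\<forall>x y. ip (T x) y = ip x (S y))"

definition adjointables :: "('h \<Rightarrow> 'h \<Rightarrow> 'a) \<Rightarrow> ('h \<Rightarrow> 'h) set" where
  "adjointables ip = {T. \<exists>S. is_adjoint ip T S}"

definition adj :: "('h \<Rightarrow> 'h \<Rightarrow> 'a) \<Rightarrow> ('h \<Rightarrow> 'h) \<Rightarrow> 'h \<Rightarrow> 'h" where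
  "adj ip T = (THE S. is_adjoint ip T S)"

definition self_adjoints :: "('h \<Rightarrow> 'h \<Rightarrow> 'a) \<Rightarrow> ('h \<Rightarrow> 'h) set" where
  "self_adjoints ip = {T \<in> adjointables ip. adj ip T = T}"

definition op_spectrum :: "('h::complex_vector \<Rightarrow> 'h \<Rightarrow> 'a) \<Rightarrow> ('h \<Rightarrow> 'h) \<Rightarrow> complex set" where
  "op_spectrum ip T = {\<zeta>. \<not> (\<exists>S\<in>adjointables ip.
      (\<lambda>x. \<zeta> *\<^sub>C x - T x) \<circ> S = id \<and> S \<circ> (\<lambda>x. \<zeta> *\<^sub>C x - T x) = id)}"

definition positives :: "('h::complex_vector \<Rightarrow> 'h \<Rightarrow> 'a) \<Rightarrow> ('h \<Rightarrow> 'h) set" where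
  "positives ip = {T \<in> self_adjoints ip. op_spectrum ip T \<subseteq> \<real>\<^sub>\<ge>\<^sub>0}"

definition op_sqrt :: "('h::complex_vector \<Rightarrow> 'h \<Rightarrow> 'a) \<Rightarrow> ('h \<Rightarrow> 'h) \<Rightarrow> 'h \<Rightarrow> 'h" where
  "op_sqrt ip T = (THE S. S \<in> positives ip \<and> S \<circ> S = T)"

definition op_abs :: "('h::complex_vector \<Rightarrow> 'h \<Rightarrow> 'a) \<Rightarrow> ('h \<Rightarrow> 'h) \<Rightarrow> 'h \<Rightarrow> 'h" where
  "op_abs ip T = op_sqrt ip (adj ip T \<circ> T)"

definition projections :: "('h \<Rightarrow> 'h \<Rightarrow> 'a) \<Rightarrow> ('h \<Rightarrow> 'h) set" where
  "projections ip = {p \<in> self_adjoints ip. p \<circ> p = p}"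

definition partial_isometry :: "('h \<Rightarrow> 'h \<Rightarrow> 'a) \<Rightarrow> ('h \<Rightarrow> 'h) \<Rightarrow> bool" where
  "partial_isometry ip W \<longleftrightarrow> W \<in> adjointables ip \<and> adj ip W \<circ> W \<in> projections ip"


section \<open>Orthogonal complements and polar decompositions\<close>

definition closed_submodule ::
    "('h::{complex_vector, banach} \<Rightarrow> 'a \<Rightarrow> 'h) \<Rightarrow> 'h set \<Rightarrow> bool" where
  "closed_submodule act M \<longleftrightarrow>
     closed M \<and> 0 \<in> M \<and> (\<forall>x\<in>M. \<forall>y\<in>M. x + y \<in> M)
     \<and> (\<forall>c. \<forall>x\<in>M. c *\<^sub>C x \<in> M) \<and> (\<forall>a. \<forall>x\<in>M. act x a \<in> M)"

definition perp :: "('h \<Rightarrow> 'h \<Rightarrow> 'a::zero) \<Rightarrow> 'h set \<Rightarrow> 'h set" where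
  "perp ip M = {x. \<forall>y\<in>M. ip x y = 0}"

definition orthogonally_complemented ::
    "('h::{complex_vector, banach} \<Rightarrow> 'a::zero \<Rightarrow> 'h) \<Rightarrow> ('h \<Rightarrow> 'h \<Rightarrow> 'a) \<Rightarrow> 'h set \<Rightarrow> bool" where
  "orthogonally_complemented act ip M \<longleftrightarrow>
     closed_submodule act M
     \<and> (\<forall>x. \<exists>y\<in>M. \<exists>z\<in>perp ip M. x = y + z) \<and> M \<inter> perp ip M = {0}"

definition proj_onto :: "('h::ab_group_add \<Rightarrow> 'h \<Rightarrow> 'a::zero) \<Rightarrow> 'h set \<Rightarrow> 'h \<Rightarrow> 'h" where
  "proj_onto ip M x = (THE y. y \<in> M \<and> x - y \<in> perp ip M)"

text \<open>\<open>polar_decomposition act ip T U\<close> says that \<open>T = U |T|\<close> is the polar decomposition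
  of \<open>T\<close>.\<close>

definition polar_decomposition ::
    "('h::{complex_vector, banach} \<Rightarrow> 'a::zero \<Rightarrow> 'h) \<Rightarrow> ('h \<Rightarrow> 'h \<Rightarrow> 'a) \<Rightarrow>
     ('h \<Rightarrow> 'h) \<Rightarrow> ('h \<Rightarrow> 'h) \<Rightarrow> bool" where
  "polar_decomposition act ip T U \<longleftrightarrow>
     partial_isometry ip U
     \<and> T = U \<circ> op_abs ip T
     \<and> orthogonally_complemented act ip (closure (range (adj ip T)))
     \<and> adj ip U \<circ> U = proj_onto ip (closure (range (adj ip T)))"

end

theory Submission
  imports Defs
begin

text \<open>Both parts reduce to algebra with projections once square roots of adjointable operators are at
  hand.
  If \<open>A\<close> and \<open>B\<close> are positive and commute, then \<open>A B\<close> is positive and equals \<open>|A B|\<close>, while the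
  projections onto the closures of the ranges commute and their product is the projection onto the
  closure of the range of \<open>A B\<close> (\<open>polar_decomposition_commuting_positives\<close>). Conversely, a product \<open>p q\<close> of
  projections that is a partial isometry is itself a projection, so a polar decomposition
  \<open>A B = p q |A B|\<close> forces \<open>A B = |A B|\<close>, which is self-adjoint
  (\<open>commute_of_polar_decomposition_projections\<close>).

  The substance lies in what this takes for granted: existence and uniqueness of
  the positive root \<open>|T|\<close> of \<open>T* T\<close>, and positivity of products of commuting positive operators,
  where positivity is defined by the spectrum. All of it is derived without Gelfand theory or a
  functional calculus. The cone \<open>positive_op\<close> of hermitian \<open>X\<close> with
  \<open>norm (t - X) \<le> t\<close> for some \<open>t \<ge> 0\<close> is convex by the triangle inequality. An elementary iteration
  yields square roots in it that commute with everything the given operator commutes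
  with (\<open>positive_op_sqrt\<close>); squares of hermitian operators and products of commuting
  positive operators therefore stay in the cone, and roots are unique. A hermitian \<open>X\<close> belongs
  to the cone as soon as every \<open>X + s\<close>, \<open>s > 0\<close>, is bounded below
  (\<open>positive_op_of_bounded_below\<close>). This criterion identifies the cone with the spectrally positive
  operators, and it applies to \<open>T* T\<close>, because
  \<open>\<langle>x, (T* T + s) x\<rangle> = \<langle>T x, T x\<rangle> + s \<langle>x, x\<rangle>\<close>.

  That last step, like the Cauchy-Schwarz inequality for \<open>H\<close>, needs
  \<open>norm a \<le> norm (a + b)\<close> for positive \<open>a\<close>, \<open>b\<close> in the C*-algebra. This is an instance of the same
  theory, applied to the left multiplications of the algebra on itself.\<close>

section \<open>Complex vector spaces and C*-algebras\<close>

lemma scaleC_zero_right [simp]: "c *\<^sub>C (0::'a::complex_vector) = 0"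
  using scaleC_add_right[of c 0 "0::'a"] by simp

lemma scaleC_one [simp]: "1 *\<^sub>C (x::'a::complex_vector) = x"
  using scaleR_scaleC[of 1 x] by simp

lemma scaleC_minus_right [simp]: "c *\<^sub>C (- x::'a::complex_vector) = - (c *\<^sub>C x)"
  using scaleC_add_right[of c x "- x"] by (simp add: eq_neg_iff_add_eq_0 add.commute)

lemma scaleC_minus_left: "(- c) *\<^sub>C (x::'a::complex_vector) = - (c *\<^sub>C x)"
  using scaleC_scaleC[of "-1" c x] scaleR_scaleC[of "-1" "c *\<^sub>C x"] by simp

lemma scaleC_diff_right: "c *\<^sub>C (x - y::'a::complex_vector) = c *\<^sub>C x - c *\<^sub>C y"
  using scaleC_add_right[of c x "- y"] by simp

lemma scaleC_scaleR: "c *\<^sub>C (r *\<^sub>R (x::'a::complex_vector)) = r *\<^sub>R (c *\<^sub>C x)"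
  by (simp add: scaleR_scaleC scaleC_scaleC mult.commute)

lemma star_minus: "star (- x::'a::cstar_algebra) = - star x"
proof -
  have "star 0 = (0::'a)"
    using star_add[of 0 "0::'a"] by simp
  then show ?thesis
    using star_add[of x "- x"] by (simp add: eq_neg_iff_add_eq_0 add.commute)
qed

lemma norm_star [simp]: "norm (star x) = norm (x::'a::cstar_algebra)"
proof -
  have le: "norm y \<le> norm (star y)" for y :: 'a
  proof (cases "norm y = 0")
    case False
    have "norm y * norm y \<le> norm (star y) * norm y"
      using norm_mult_ineq[of "star y" y] cstar_identity[of y] by (simp add: power2_eq_square)
    then show ?thesis using False by simp
  qed simp
  show ?thesis using le[of x] le[of "star x"] by (simp add: star_star)
qed

lemma star_diff: "star (x - y::'a::cstar_algebra) = star x - star y"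
  using star_add[of x "- y"] by (simp add: star_minus)

lemma star_zero [simp]: "star (0::'a::cstar_algebra) = 0"
  using star_diff[of 0 "0::'a"] by simp

section \<open>Spaces with a C*-valued inner product\<close>

text \<open>The Cauchy-Schwarz inequality is an axiom here and takes the place of positivity of
  \<open>ip x x\<close>, because the theory is instantiated twice. For a C*-algebra with \<open>star a * b\<close> the
  inequality is immediate, whereas positivity of \<open>star a * a\<close> is a deep fact; for a Hilbert
  module the inequality is itself derived from the first instance.\<close>

locale cstar_inner_space =
  fixes ip :: "'h::{complex_vector, banach} \<Rightarrow> 'h \<Rightarrow> 'a::cstar_algebra"
  assumes ip_add_right: "ip x (y + z) = ip x y + ip x z"
    and ip_scaleC_right: "ip x (c *\<^sub>C y) = c *\<^sub>C ip x y"
    and star_ip: "star (ip x y) = ip y x"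
    and norm_ip_self: "norm (ip x x) = (norm x)\<^sup>2"
    and norm_ip_le: "norm (ip x y) \<le> norm x * norm y"
begin

lemma ip_add_left: "ip (x + y) z = ip x z + ip y z"
  by (metis ip_add_right star_add star_ip)

lemma ip_scaleC_left: "ip (c *\<^sub>C x) y = cnj c *\<^sub>C ip x y"
  by (metis ip_scaleC_right star_scaleC star_ip)

lemma ip_scaleR_right: "ip x (r *\<^sub>R y) = r *\<^sub>R ip x y"
  by (simp add: scaleR_scaleC ip_scaleC_right)

lemma ip_scaleR_left: "ip (r *\<^sub>R x) y = r *\<^sub>R ip x y"
  by (simp add: scaleR_scaleC ip_scaleC_left)

lemma ip_zero_right [simp]: "ip x 0 = 0"
  using ip_add_right[of x 0 0] by simp

lemma ip_zero_left [simp]: "ip 0 x = 0"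
  using ip_add_left[of 0 0 x] by simp

lemma ip_minus_right: "ip x (- y) = - ip x y"
  using ip_scaleR_right[of x "-1" y] by simp

lemma ip_minus_left: "ip (- x) y = - ip x y"
  using ip_scaleR_left[of "-1" x y] by simp

lemma ip_diff_right: "ip x (y - z) = ip x y - ip x z"
  using ip_add_right[of x y "- z"] by (simp add: ip_minus_right)

lemma ip_diff_left: "ip (x - y) z = ip x z - ip y z"
  using ip_add_left[of x "- y" z] by (simp add: ip_minus_left)

lemmas ip_algebra = ip_add_right ip_add_left ip_diff_right ip_diff_left ip_minus_left
  ip_minus_right ip_scaleR_right ip_scaleR_left

lemma ip_self_eq_0 [simp]: "ip x x = 0 \<longleftrightarrow> x = 0"
  using norm_ip_self[of x] by auto

lemma ip_eqI: assumes "\<And>z. ip x z = ip y z" shows "x = y"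
  using assms[of "x - y"] ip_self_eq_0[of "x - y"] by (simp add: ip_diff_left)

lemma ip_eqI_right: assumes "\<And>z. ip z x = ip z y" shows "x = y"
  by (rule ip_eqI) (metis assms star_ip)

lemma norm_scaleC_vec: "norm (c *\<^sub>C (x::'h)) = cmod c * norm x"
proof -
  have "(norm (c *\<^sub>C x))\<^sup>2 = cmod c * (cmod c * norm (ip x x))"
    unfolding norm_ip_self[symmetric] by (simp add: ip_scaleC_left ip_scaleC_right norm_scaleC)
  then have "(norm (c *\<^sub>C x))\<^sup>2 = (cmod c * norm x)\<^sup>2"
    by (simp add: norm_ip_self power2_eq_square)
  then show ?thesis by (simp add: power2_eq_iff_nonneg)
qed

lemma bounded_linear_ip_right: "bounded_linear (ip x)"
  by (rule bounded_linear_intro[of _ "norm x"])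
    (simp_all add: ip_add_right ip_scaleR_right, metis norm_ip_le mult.commute)

lemma bounded_linear_ip_left: "bounded_linear (\<lambda>x. ip x y)"
  by (rule bounded_linear_intro[of _ "norm y"])
    (auto simp: ip_add_left ip_scaleR_left norm_ip_le)

subsection \<open>Adjoints\<close>

lemma is_adjoint_sym: "is_adjoint ip T S \<Longrightarrow> is_adjoint ip S T"
  unfolding is_adjoint_def by (metis star_ip)

lemma is_adjoint_unique: "is_adjoint ip T S \<Longrightarrow> is_adjoint ip T S' \<Longrightarrow> S = S'"
  unfolding is_adjoint_def by (metis ip_eqI_right ext)

lemma adj_eqI: "is_adjoint ip T S \<Longrightarrow> adj ip T = S"
  unfolding adj_def using is_adjoint_unique by blast

lemma is_adjoint_scaleC:
  assumes "is_adjoint ip T S" shows "T (c *\<^sub>C x) = c *\<^sub>C T x"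
  using assms by (intro ip_eqI) (simp add: is_adjoint_def ip_scaleC_left)

text \<open>The uniform boundedness principle makes every adjointable operator bounded: the sets
  \<open>{x. \<forall>y. norm y \<le> 1 \<longrightarrow> norm (ip x (S y)) \<le> n}\<close> are closed and cover the whole space, so by
  Baire one of them contains a ball, and on it \<open>T\<close> is bounded by \<open>n\<close> because the norm
  of \<open>T x\<close> is attained by pairing with multiples of \<open>T x\<close> itself.\<close>

lemma is_adjoint_bounded_linear:
  assumes adj: "is_adjoint ip T S"
  shows "bounded_linear T"
proof -
  have TS: "ip (T x) y = ip x (S y)" for x y
    using adj by (simp add: is_adjoint_def)
  have add: "T (x + y) = T x + T y" for x y
    by (rule ip_eqI) (simp add: TS ip_add_left)
  have scale: "T (r *\<^sub>R x) = r *\<^sub>R T x" for r x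
    by (rule ip_eqI) (simp add: TS ip_scaleR_left)
  define F where "F n = {x. \<forall>y. norm (ip x (S y)) \<le> real n * norm y}" for n :: nat
  have F_norm: "norm (T x) \<le> real n" if "x \<in> F n" for x n
  proof (cases "T x = 0")
    case False
    have "norm (ip x (S (T x))) \<le> real n * norm (T x)"
      using that by (simp add: F_def)
    then have "norm (T x) * norm (T x) \<le> real n * norm (T x)"
      unfolding TS[symmetric] norm_ip_self power2_eq_square .
    then show ?thesis using False by simp
  qed simp
  have F_closed: "closed (F n)" for n
  proof -
    have "closed {x. norm (ip x (S y)) \<le> real n * norm y}" for y
      by (intro closed_Collect_le continuous_intros
          bounded_linear.continuous_on[OF bounded_linear_ip_left])
    moreover have "F n = (\<Inter>y. {x. norm (ip x (S y)) \<le> real n * norm y})"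
      by (auto simp: F_def)
    ultimately show ?thesis by (simp add: closed_INT)
  qed
  have F_cover: "(\<Union>n. F n) = UNIV"
  proof -
    have "\<exists>n. x \<in> F n" for x
    proof -
      obtain n :: nat where n: "norm (T x) \<le> real n" using real_arch_simple by blast
      have "norm (ip x (S y)) \<le> real n * norm y" for y
        using norm_ip_le[of "T x" y] mult_right_mono[OF n norm_ge_zero[of y]] by (simp add: TS)
      then show ?thesis by (auto simp: F_def)
    qed
    then show ?thesis by auto
  qed
  have "\<exists>n. interior (F n) \<noteq> {}"
  proof (rule ccontr)
    assume "\<not> ?thesis"
    then have "euclidean interior_of \<Union>(range F) = {}"
      by (intro Baire_category_alt)
        (auto simp: completely_metrizable_space_euclidean F_closed)
    then show False by (simp add: F_cover)
  qed
  then obtain n x0 where "x0 \<in> interior (F n)" by auto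
  then obtain e where e: "e > 0" "cball x0 e \<subseteq> F n"
    by (meson mem_interior_cball)
  have "norm (T x) \<le> norm x * (2 * real n / e)" for x
  proof (cases "x = 0")
    case True
    then show ?thesis using scale[of 0 0] by simp
  next
    case False
    define z where "z = (e / norm x) *\<^sub>R x"
    have "norm z = e" using False e(1) by (simp add: z_def)
    then have "x0 + z \<in> F n" "x0 \<in> F n"
      using e by (auto simp: dist_norm subset_iff)
    then have "norm (T (x0 + z)) \<le> n" "norm (T x0) \<le> n"
      by (auto intro: F_norm)
    then have "norm (T z) \<le> 2 * real n"
      using norm_triangle_ineq4[of "T (x0 + z)" "T x0"] by (simp add: add)
    then show ?thesis
      using False e(1) by (simp add: z_def scale field_simps)
  qed
  then show ?thesis
    by (intro bounded_linear_intro[of _ "2 * real n / e"]) (auto simp: add scale)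
qed

subsection \<open>Hermitian operators\<close>

definition hermitian :: "('h \<Rightarrow> 'h) \<Rightarrow> bool" where
  "hermitian T \<longleftrightarrow> (\<forall>x y. ip (T x) y = ip x (T y))"

lemma hermitianI: "(\<And>x y. ip (T x) y = ip x (T y)) \<Longrightarrow> hermitian T"
  by (simp add: hermitian_def)

lemma hermitianD: "hermitian T \<Longrightarrow> ip (T x) y = ip x (T y)"
  by (simp add: hermitian_def)

lemma hermitian_iff_is_adjoint: "hermitian T \<longleftrightarrow> is_adjoint ip T T"
  by (simp add: hermitian_def is_adjoint_def)

lemma self_adjoints_iff_hermitian: "T \<in> self_adjoints ip \<longleftrightarrow> hermitian T"
proof
  assume T: "T \<in> self_adjoints ip"
  then obtain S where S: "is_adjoint ip T S"
    by (auto simp: self_adjoints_def adjointables_def)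
  then have "S = T" using T by (simp add: self_adjoints_def adj_eqI)
  then show "hermitian T" using S by (simp add: hermitian_iff_is_adjoint)
next
  assume "hermitian T"
  then show "T \<in> self_adjoints ip"
    by (auto simp: self_adjoints_def adjointables_def hermitian_iff_is_adjoint adj_eqI)
qed

lemma hermitian_bounded_linear: "hermitian T \<Longrightarrow> bounded_linear T"
  by (auto simp: hermitian_iff_is_adjoint intro: is_adjoint_bounded_linear)

lemma hermitian_algebra:
  assumes "hermitian T"
  shows "T (x + y) = T x + T y" "T (x - y) = T x - T y" "T (- x) = - T x" "T 0 = 0"
    "T (r *\<^sub>R x) = r *\<^sub>R T x" "T (c *\<^sub>C x) = c *\<^sub>C T x"
  using bounded_linear.linear[OF hermitian_bounded_linear[OF assms]] assms
  by (auto simp: linear_add linear_diff linear_neg linear_0 linear_cmul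
      hermitian_iff_is_adjoint intro: is_adjoint_scaleC)

lemma hermitian_zero: "hermitian (\<lambda>x. 0)"
  by (simp add: hermitian_def)

lemma hermitian_id: "hermitian (\<lambda>x. x)"
  by (simp add: hermitian_def)

lemma hermitian_add: "hermitian S \<Longrightarrow> hermitian T \<Longrightarrow> hermitian (\<lambda>x. S x + T x)"
  by (simp add: hermitian_def ip_algebra)

lemma hermitian_diff: "hermitian S \<Longrightarrow> hermitian T \<Longrightarrow> hermitian (\<lambda>x. S x - T x)"
  by (simp add: hermitian_def ip_algebra)

lemma hermitian_scaleR: "hermitian T \<Longrightarrow> hermitian (\<lambda>x. r *\<^sub>R T x)"
  by (simp add: hermitian_def ip_algebra)

lemma hermitian_compose:
  assumes "hermitian S" "hermitian T" "\<And>x. S (T x) = T (S x)"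
  shows "hermitian (\<lambda>x. S (T x))"
  using assms by (simp add: hermitian_def)

lemmas hermitian_intros = hermitian_zero hermitian_id hermitian_add hermitian_diff hermitian_scaleR

lemma hermitian_inverse:
  assumes "hermitian T" "\<And>x. T (R x) = x"
  shows "hermitian R"
  by (rule hermitianI) (metis assms hermitianD)

end

section \<open>Square roots of contractions\<close>

definition bounded_by :: "real \<Rightarrow> ('h::real_normed_vector \<Rightarrow> 'h) \<Rightarrow> bool" where
  "bounded_by k T \<longleftrightarrow> (\<forall>x. norm (T x) \<le> k * norm x)"

lemma bounded_byD: "bounded_by k T \<Longrightarrow> norm (T x) \<le> k * norm x"
  by (simp add: bounded_by_def)

lemma bounded_by_mono: "bounded_by k T \<Longrightarrow> k \<le> l \<Longrightarrow> bounded_by l T"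
  unfolding bounded_by_def by (meson mult_right_mono norm_ge_zero order_trans)

lemma bounded_by_compose:
  assumes S: "bounded_by k S" and T: "bounded_by l T" and "k \<ge> 0"
  shows "bounded_by (k * l) (\<lambda>x. S (T x))"
  unfolding bounded_by_def
proof
  fix x
  have "norm (S (T x)) \<le> k * norm (T x)" using S by (rule bounded_byD)
  also have "\<dots> \<le> k * (l * norm x)" using \<open>k \<ge> 0\<close> bounded_byD[OF T] by (rule mult_left_mono[rotated])
  finally show "norm (S (T x)) \<le> k * l * norm x" by simp
qed

lemma bounded_linear_bounded_by:
  assumes "bounded_linear T" obtains k where "k > 0" "bounded_by k T"
  using bounded_linear.pos_bounded[OF assms] by (auto simp: bounded_by_def mult.commute)

text \<open>A square root \<open>1 - W\<close> of \<open>1 - Z\<close> is a solution of \<open>2 W = Z + W\<^sup>2\<close>, which \<open>root_iter\<close> solves by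
  iteration. For \<open>Z = 1\<close> the iterates are the numbers \<open>scalar_iter n\<close>, which increase and stay
  below \<open>1\<close>; they majorize the iteration for every contraction \<open>Z\<close>, so no power
  series and no functional calculus are needed.\<close>

fun scalar_iter :: "nat \<Rightarrow> real" where
  "scalar_iter 0 = 0"
| "scalar_iter (Suc n) = (1 + (scalar_iter n)\<^sup>2) / 2"

lemma scalar_iter_bounds: "0 \<le> scalar_iter n \<and> scalar_iter n \<le> 1"
  by (induction n) (auto simp: power_le_one)

lemma scalar_iter_increasing: "scalar_iter n \<le> scalar_iter (Suc n)"
proof -
  have "0 \<le> (1 - scalar_iter n)\<^sup>2" by simp
  then show ?thesis by (simp add: power2_eq_square algebra_simps)
qed

lemma scalar_iter_Cauchy: "Cauchy scalar_iter"
proof (rule convergent_Cauchy, rule Bseq_monoseq_convergent)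
  show "Bseq scalar_iter"
    by (rule BseqI'[of _ 1]) (use scalar_iter_bounds in auto)
  show "monoseq scalar_iter"
    using incseq_SucI[of scalar_iter, OF scalar_iter_increasing] by (simp add: monoseq_iff)
qed

fun root_iter :: "('h::real_vector \<Rightarrow> 'h) \<Rightarrow> nat \<Rightarrow> 'h \<Rightarrow> 'h" where
  "root_iter Z 0 = (\<lambda>x. 0)"
| "root_iter Z (Suc n) = (\<lambda>x. (1 / 2) *\<^sub>R (Z x + root_iter Z n (root_iter Z n x)))"

context cstar_inner_space
begin

lemma root_iter_hermitian: "hermitian Z \<Longrightarrow> hermitian (root_iter Z n)"
  by (induction n) (auto intro!: hermitian_intros intro: hermitian_compose)

lemma root_iter_bounded:
  assumes "bounded_by 1 Z"
  shows "bounded_by (scalar_iter n) (root_iter Z n)"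
proof (induction n)
  case 0
  then show ?case by (simp add: bounded_by_def)
next
  case (Suc n)
  have "norm (root_iter Z (Suc n) x) \<le> scalar_iter (Suc n) * norm x" for x
  proof -
    have "norm (Z x + root_iter Z n (root_iter Z n x))
        \<le> norm x + scalar_iter n * scalar_iter n * norm x"
      using bounded_byD[OF assms, of x]
        bounded_byD[OF bounded_by_compose[OF Suc Suc], of x] scalar_iter_bounds[of n]
      by (intro norm_triangle_mono) auto
    then show ?thesis by (simp add: power2_eq_square distrib_right)
  qed
  then show ?case by (simp add: bounded_by_def)
qed

text \<open>The operator iteration is dominated term by term by the scalar one, because
  \<open>2 (W'' - W') = W' (W' - W) + (W' - W) W\<close> for consecutive iterates.\<close>

lemma root_iter_step:
  assumes Z: "hermitian Z" "bounded_by 1 Z"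
  shows "norm (root_iter Z (Suc n) x - root_iter Z n x)
    \<le> (scalar_iter (Suc n) - scalar_iter n) * norm x"
proof (induction n arbitrary: x)
  case 0
  then show ?case using bounded_byD[OF Z(2), of x] by simp
next
  case (Suc n)
  let ?W = "root_iter Z n" and ?V = "root_iter Z (Suc n)"
  let ?w = "scalar_iter n" and ?v = "scalar_iter (Suc n)"
  note herm = hermitian_algebra[OF root_iter_hermitian[OF Z(1)]]
  have "norm (?V (?V x - ?W x)) \<le> ?v * ((?v - ?w) * norm x)"
    using bounded_byD[OF root_iter_bounded[OF Z(2)], of "Suc n" "?V x - ?W x"]
      mult_left_mono[OF Suc[of x], of ?v] scalar_iter_bounds[of "Suc n"] by linarith
  moreover have "norm (?V (?W x) - ?W (?W x)) \<le> (?v - ?w) * (?w * norm x)"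
    using Suc[of "?W x"] mult_left_mono[OF bounded_byD[OF root_iter_bounded[OF Z(2)], of n x],
        of "?v - ?w"] scalar_iter_increasing[of n] by linarith
  ultimately have "norm (?V (?V x - ?W x) + (?V (?W x) - ?W (?W x)))
      \<le> ?v * ((?v - ?w) * norm x) + (?v - ?w) * (?w * norm x)"
    by (rule norm_triangle_mono)
  also have "\<dots> = (?v\<^sup>2 - ?w\<^sup>2) * norm x"
    by (simp only: power2_eq_square algebra_simps)
  also have "?V (?V x - ?W x) + (?V (?W x) - ?W (?W x)) = ?V (?V x) - ?W (?W x)"
    by (simp only: herm) simp
  also have "\<dots> = 2 *\<^sub>R (root_iter Z (Suc (Suc n)) x - ?V x)"
    by (simp only: root_iter.simps(2)[of Z "Suc n"] scaleR_diff_right scaleR_scaleR)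
      (simp add: scaleR_add_right)
  also have "?v\<^sup>2 - ?w\<^sup>2 = 2 * (scalar_iter (Suc (Suc n)) - ?v)"
    by (simp only: scalar_iter.simps(2)[of "Suc n"]) (simp add: field_simps)
  finally show ?case by (simp del: root_iter.simps scalar_iter.simps add: left_diff_distrib)
qed

lemma root_iter_dist:
  assumes Z: "hermitian Z" "bounded_by 1 Z" and "m \<le> n"
  shows "norm (root_iter Z n x - root_iter Z m x) \<le> (scalar_iter n - scalar_iter m) * norm x"
  using \<open>m \<le> n\<close>
proof (induction n rule: dec_induct)
  case base
  then show ?case by simp
next
  case (step n)
  have "norm ((root_iter Z (Suc n) x - root_iter Z n x) + (root_iter Z n x - root_iter Z m x))
      \<le> (scalar_iter (Suc n) - scalar_iter n) * norm x
        + (scalar_iter n - scalar_iter m) * norm x"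
    by (intro norm_triangle_mono root_iter_step Z step.IH)
  then show ?case by (simp del: root_iter.simps scalar_iter.simps add: algebra_simps)
qed

text \<open>The limit \<open>W\<close> commutes with everything that commutes with \<open>Z\<close>, because each iterate
  does. This lets roots of commuting operators commute with one another.\<close>

lemma contraction_root:
  assumes Z: "hermitian Z" "bounded_by 1 Z"
  obtains W where "hermitian W" "bounded_by 1 W" "\<And>x. 2 *\<^sub>R W x = Z x + W (W x)"
    "\<And>D x. hermitian D \<Longrightarrow> (\<And>y. D (Z y) = Z (D y)) \<Longrightarrow> D (W x) = W (D x)"
proof -
  let ?W = "root_iter Z"
  have "Cauchy (\<lambda>n. ?W n x)" for x
  proof (rule metric_CauchyI)
    fix e :: real assume "e > 0"
    then have "e / (norm x + 1) > 0" by (simp add: add_nonneg_pos)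
    then obtain M where M: "\<And>m n. m \<ge> M \<Longrightarrow> n \<ge> M \<Longrightarrow>
        dist (scalar_iter m) (scalar_iter n) < e / (norm x + 1)"
      using scalar_iter_Cauchy unfolding Cauchy_def by blast
    have less: "dist (?W n x) (?W m x) < e" if "M \<le> m" "m \<le> n" for m n
    proof -
      have "dist (?W n x) (?W m x) \<le> (scalar_iter n - scalar_iter m) * norm x"
        unfolding dist_norm by (rule root_iter_dist[OF Z that(2)])
      also have "\<dots> \<le> dist (scalar_iter n) (scalar_iter m) * norm x"
        by (intro mult_right_mono) (auto simp: dist_real_def)
      also have "\<dots> \<le> e / (norm x + 1) * norm x"
        using M[of n m] that by (intro mult_right_mono) auto
      also have "\<dots> < e"
        using \<open>e > 0\<close> by (simp add: field_simps add_pos_nonneg)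
      finally show ?thesis .
    qed
    show "\<exists>M. \<forall>m\<ge>M. \<forall>n\<ge>M. dist (?W m x) (?W n x) < e"
      by (metis less linorder_le_cases dist_commute)
  qed
  then have "\<exists>y. (\<lambda>n. ?W n x) \<longlonglongrightarrow> y" for x
    by (simp add: Cauchy_convergent_iff convergent_def)
  then obtain W where W: "\<And>x. (\<lambda>n. ?W n x) \<longlonglongrightarrow> W x" by metis
  have herm: "hermitian (?W n)" for n by (rule root_iter_hermitian[OF Z(1)])
  have bound: "bounded_by 1 (?W n)" for n
    using root_iter_bounded[OF Z(2), of n] scalar_iter_bounds[of n] by (blast intro: bounded_by_mono)
  have hermW: "hermitian W"
  proof (rule hermitianI)
    fix x y
    have "(\<lambda>n. ip (?W n x) y) \<longlonglongrightarrow> ip (W x) y"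
      by (rule bounded_linear.tendsto[OF bounded_linear_ip_left W])
    moreover have "(\<lambda>n. ip (?W n x) y) \<longlonglongrightarrow> ip x (W y)"
      unfolding hermitianD[OF herm] by (rule bounded_linear.tendsto[OF bounded_linear_ip_right W])
    ultimately show "ip (W x) y = ip x (W y)" by (rule LIMSEQ_unique)
  qed
  have boundW: "bounded_by 1 W"
    unfolding bounded_by_def
    by (intro allI LIMSEQ_le_const2[OF tendsto_norm[OF W]]) (metis bounded_byD[OF bound])
  have square: "(\<lambda>n. ?W n (?W n x)) \<longlonglongrightarrow> W (W x)" for x
  proof -
    have "(\<lambda>n. ?W n (?W n x - W x)) \<longlonglongrightarrow> 0"
    proof (rule Lim_null_comparison)
      show "\<forall>\<^sub>F n in sequentially. norm (?W n (?W n x - W x)) \<le> norm (?W n x - W x)"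
        using bounded_byD[OF bound] by (auto intro: always_eventually)
      show "(\<lambda>n. norm (?W n x - W x)) \<longlonglongrightarrow> 0"
        using W[of x] by (simp add: LIM_zero tendsto_norm_zero)
    qed
    from tendsto_add[OF this W[of "W x"]] show ?thesis
      by (simp add: hermitian_algebra[OF herm])
  qed
  have eq: "2 *\<^sub>R W x = Z x + W (W x)" for x
  proof -
    have "(\<lambda>n. 2 *\<^sub>R ?W (Suc n) x) \<longlonglongrightarrow> 2 *\<^sub>R W x"
      by (intro tendsto_scaleR tendsto_const LIMSEQ_Suc W)
    moreover have "(\<lambda>n. 2 *\<^sub>R ?W (Suc n) x) \<longlonglongrightarrow> Z x + W (W x)"
      using tendsto_add[OF tendsto_const square] by simp
    ultimately show ?thesis by (rule LIMSEQ_unique)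
  qed
  have comm: "D (W x) = W (D x)" if D: "hermitian D" and DZ: "\<And>y. D (Z y) = Z (D y)" for D x
  proof -
    have "D (?W n y) = ?W n (D y)" for n y
      by (induction n arbitrary: y) (simp_all add: hermitian_algebra[OF D] DZ)
    moreover have "(\<lambda>n. D (?W n x)) \<longlonglongrightarrow> D (W x)"
      by (rule bounded_linear.tendsto[OF hermitian_bounded_linear[OF D] W])
    ultimately show ?thesis using W[of "D x"] by (simp add: LIMSEQ_unique)
  qed
  show thesis by (rule that[OF hermW boundW eq comm])
qed

section \<open>The cone of positive operators\<close>

text \<open>The norm condition says that the spectrum of the hermitian operator \<open>X\<close> lies in the disc of
  radius \<open>t\<close> around \<open>t\<close>, hence in \<open>[0, 2 t]\<close>. In this form, due to Kelley and Vaught, sums of positive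
  operators are positive by the triangle inequality. The equivalence with
  the spectral definition is \<open>positives_iff_positive_op\<close>.\<close>

definition positive_op :: "('h \<Rightarrow> 'h) \<Rightarrow> bool" where
  "positive_op X \<longleftrightarrow> hermitian X \<and> (\<exists>t\<ge>0. bounded_by t (\<lambda>x. t *\<^sub>R x - X x))"

lemma positive_op_hermitian: "positive_op X \<Longrightarrow> hermitian X"
  by (simp add: positive_op_def)

lemma positive_opI:
  "hermitian X \<Longrightarrow> bounded_by t (\<lambda>x. t *\<^sub>R x - X x) \<Longrightarrow> t \<ge> 0 \<Longrightarrow> positive_op X"
  by (auto simp: positive_op_def)

lemma positive_op_witness:
  assumes "positive_op X"
  obtains t where "t > 0" "bounded_by t (\<lambda>x. t *\<^sub>R x - X x)"
proof -
  obtain t where t: "t \<ge> 0" "bounded_by t (\<lambda>x. t *\<^sub>R x - X x)"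
    using assms by (auto simp: positive_op_def)
  have "norm ((t + 1) *\<^sub>R x - X x) \<le> (t + 1) * norm x" for x
    using bounded_byD[OF t(2), of x] norm_triangle_ineq[of x "t *\<^sub>R x - X x"]
    by (simp add: algebra_simps)
  then show thesis using that[of "t + 1"] t(1) by (simp add: bounded_by_def)
qed

lemma positive_op_add:
  assumes "positive_op X" "positive_op Y"
  shows "positive_op (\<lambda>x. X x + Y x)"
proof -
  obtain s where s: "s > 0" "bounded_by s (\<lambda>x. s *\<^sub>R x - X x)"
    using assms(1) by (rule positive_op_witness)
  obtain t where t: "t > 0" "bounded_by t (\<lambda>x. t *\<^sub>R x - Y x)"
    using assms(2) by (rule positive_op_witness)
  have "norm ((s + t) *\<^sub>R x - (X x + Y x)) \<le> (s + t) * norm x" for x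
    using norm_triangle_mono[OF bounded_byD[OF s(2), of x] bounded_byD[OF t(2), of x]]
    by (simp add: algebra_simps)
  then show ?thesis
    using s(1) t(1) assms[THEN positive_op_hermitian]
    by (intro positive_opI[of _ "s + t"]) (auto simp: bounded_by_def intro: hermitian_intros)
qed

lemma positive_op_scaleR:
  assumes X: "positive_op X" and "r \<ge> 0"
  shows "positive_op (\<lambda>x. r *\<^sub>R X x)"
proof -
  obtain t where t: "t > 0" "bounded_by t (\<lambda>x. t *\<^sub>R x - X x)"
    using X by (rule positive_op_witness)
  have "norm ((r * t) *\<^sub>R x - r *\<^sub>R X x) \<le> r * t * norm x" for x
  proof -
    have "norm (r *\<^sub>R (t *\<^sub>R x - X x)) \<le> r * (t * norm x)"
      using \<open>r \<ge> 0\<close> by (simp add: mult_left_mono bounded_byD[OF t(2)])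
    then show ?thesis by (simp add: scaleR_diff_right)
  qed
  then show ?thesis
    using t(1) \<open>r \<ge> 0\<close> positive_op_hermitian[OF X]
    by (intro positive_opI[of _ "r * t"]) (auto simp: bounded_by_def intro: hermitian_intros)
qed

lemma positive_op_shift:
  assumes "hermitian X" "bounded_by k X" "k \<ge> 0"
  shows "positive_op (\<lambda>x. k *\<^sub>R x - X x)"
  using hermitian_diff[OF hermitian_scaleR[OF hermitian_id] assms(1), of k] assms(2,3)
  by (intro positive_opI[of _ k]) auto

lemma positive_op_scaleR_id: "r \<ge> 0 \<Longrightarrow> positive_op (\<lambda>x. r *\<^sub>R x)"
  using positive_op_shift[of "\<lambda>x. 0" r] by (simp add: hermitian_zero bounded_by_def)

text \<open>Dividing \<open>X\<close> by the \<open>t\<close> of its norm condition gives \<open>X / t = 1 - Z\<close> with a contraction \<open>Z\<close>,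
  and \<open>1 - W\<close> with \<open>W\<close> from \<open>contraction_root\<close> is a root of it.\<close>

lemma positive_op_sqrt:
  assumes X: "positive_op X"
  obtains C where "positive_op C" "\<And>x. C (C x) = X x"
    "\<And>D x. hermitian D \<Longrightarrow> (\<And>y. D (X y) = X (D y)) \<Longrightarrow> D (C x) = C (D x)"
proof -
  obtain t where t: "t > 0" "bounded_by t (\<lambda>x. t *\<^sub>R x - X x)"
    using X by (rule positive_op_witness)
  define Z where "Z x = (1 / t) *\<^sub>R (t *\<^sub>R x - X x)" for x
  have Z_eq: "Z x = x - (1 / t) *\<^sub>R X x" for x
    using t(1) by (simp add: Z_def scaleR_diff_right)
  have hermZ: "hermitian Z"
    unfolding Z_def using positive_op_hermitian[OF X] by (intro hermitian_intros)
  have boundZ: "bounded_by 1 Z"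
    using t by (simp add: bounded_by_def Z_def divide_simps mult.commute[of _ t])
  obtain W where W: "hermitian W" "bounded_by 1 W" "\<And>x. 2 *\<^sub>R W x = Z x + W (W x)"
    "\<And>D x. hermitian D \<Longrightarrow> (\<And>y. D (Z y) = Z (D y)) \<Longrightarrow> D (W x) = W (D x)"
    using contraction_root[OF hermZ boundZ] by blast
  define C where "C x = sqrt t *\<^sub>R (1 *\<^sub>R x - W x)" for x
  have "positive_op C"
    unfolding C_def using t(1) W(1,2) by (intro positive_op_scaleR positive_op_shift) auto
  moreover have "C (C x) = X x" for x
  proof -
    have "C (C x) = (sqrt t * sqrt t) *\<^sub>R (x - 2 *\<^sub>R W x + W (W x))"
      by (simp add: C_def hermitian_algebra[OF W(1)] algebra_simps scaleR_2)
    also have "\<dots> = t *\<^sub>R (x - Z x)"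
      using t(1) by (simp add: W(3))
    also have "\<dots> = X x"
      using t(1) by (simp add: Z_eq)
    finally show ?thesis .
  qed
  moreover have "D (C x) = C (D x)" if D: "hermitian D" "\<And>y. D (X y) = X (D y)" for D x
  proof -
    have "D (W y) = W (D y)" for y
      by (rule W(4)[OF D(1)]) (simp add: Z_eq hermitian_algebra[OF D(1)] D(2))
    then show ?thesis
      by (simp add: C_def hermitian_algebra[OF D(1)])
  qed
  ultimately show thesis by (rule that)
qed

text \<open>For commuting hermitian \<open>C\<close>, \<open>D\<close> the operators \<open>C \<plusminus> i D\<close> are normal with
  \<open>C\<^sup>2 + D\<^sup>2\<close> as the product with their adjoint.\<close>

lemma ip_normal_combination:
  assumes C: "hermitian C" and D: "hermitian D" and CD: "\<And>x. C (D x) = D (C x)"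
    and c: "cnj c = - c" "c * c = -1"
  shows "ip (C x + c *\<^sub>C D x) (C x + c *\<^sub>C D x) = ip x (C (C x) + D (D x))"
proof -
  have swap: "ip (C x) (D x) = ip (D x) (C x)"
    by (simp add: hermitianD[OF C] hermitianD[OF D] CD)
  have cancel: "c *\<^sub>C z + cnj c *\<^sub>C z = 0" for z :: 'a
    using scaleC_add_left[of c "cnj c" z] scaleR_scaleC[of 0 z] c(1) by simp
  have unit: "cnj c * c = 1" using c by simp
  have "ip (C x + c *\<^sub>C D x) (C x + c *\<^sub>C D x)
    = ip (C x) (C x) + (c *\<^sub>C ip (D x) (C x) + cnj c *\<^sub>C ip (D x) (C x))
      + (cnj c * c) *\<^sub>C ip (D x) (D x)"
    by (simp add: ip_add_left ip_add_right ip_scaleC_left ip_scaleC_right scaleC_add_right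
        scaleC_scaleC swap mult.commute)
  also have "\<dots> = ip (C x) (C x) + ip (D x) (D x)"
    unfolding cancel unit by simp
  also have "\<dots> = ip x (C (C x) + D (D x))"
    by (simp add: hermitianD[OF C] hermitianD[OF D] ip_add_right)
  finally show ?thesis .
qed

text \<open>Under this hypothesis \<open>Y \<plusminus> i C\<close> are isometries, and \<open>Y\<close> is their average.\<close>

lemma contraction_of_sum_of_squares:
  assumes Y: "hermitian Y" and C: "hermitian C" and YC: "\<And>x. Y (C x) = C (Y x)"
    and one: "\<And>x. Y (Y x) + C (C x) = x"
  shows "bounded_by 1 Y"
proof -
  have isometry: "norm (Y x + c *\<^sub>C C x) = norm x" if c: "cnj c = - c" "c * c = -1" for c x
  proof -
    have "(norm (Y x + c *\<^sub>C C x))\<^sup>2 = (norm x)\<^sup>2"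
      unfolding norm_ip_self[symmetric] ip_normal_combination[OF Y C YC c] one ..
    then show ?thesis by simp
  qed
  have "norm (Y x) \<le> norm x" for x
  proof -
    have "norm (Y x + \<i> *\<^sub>C C x) = norm x" "norm (Y x + (- \<i>) *\<^sub>C C x) = norm x"
      by (simp_all add: isometry)
    moreover have "(Y x + \<i> *\<^sub>C C x) + (Y x + (- \<i>) *\<^sub>C C x) = 2 *\<^sub>R Y x"
      by (simp add: scaleR_2 scaleC_minus_left)
    ultimately show ?thesis
      using norm_triangle_ineq[of "Y x + \<i> *\<^sub>C C x" "Y x + (- \<i>) *\<^sub>C C x"] by simp
  qed
  then show ?thesis by (simp add: bounded_by_def)
qed

lemma contraction_compose_bounded:
  "bounded_by 1 S \<Longrightarrow> bounded_by 1 T \<Longrightarrow> bounded_by 1 (\<lambda>x. S (T x))"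
  using bounded_by_compose[of 1 S 1 T] by simp

text \<open>Let \<open>C\<close> be a square root of \<open>1 - Y\<^sup>2\<close>. Since \<open>C\<^sup>2 + Y\<^sup>2 = 1\<close>, also \<open>C\<close> is a contraction, and
  so is its square.\<close>

lemma contraction_one_minus_square:
  assumes Y: "hermitian Y" "bounded_by 1 Y"
  shows "bounded_by 1 (\<lambda>x. x - Y (Y x))"
proof -
  have "positive_op (\<lambda>x. 1 *\<^sub>R x - Y (Y x))"
    by (rule positive_op_shift[OF hermitian_compose[OF Y(1) Y(1) refl]
          contraction_compose_bounded[OF Y(2) Y(2)]]) simp
  then obtain C where C: "positive_op C" "\<And>x. C (C x) = 1 *\<^sub>R x - Y (Y x)"
    "\<And>D x. hermitian D \<Longrightarrow> (\<And>y. D (1 *\<^sub>R y - Y (Y y)) = 1 *\<^sub>R D y - Y (Y (D y)))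
      \<Longrightarrow> D (C x) = C (D x)"
    by (rule positive_op_sqrt) blast
  have "bounded_by 1 C"
  proof (rule contraction_of_sum_of_squares)
    show "C (Y x) = Y (C x)" for x
      by (rule C(3)[OF Y(1), symmetric]) (simp add: hermitian_algebra[OF Y(1)])
  qed (use C(1,2) Y(1) in \<open>auto simp: positive_op_hermitian\<close>)
  from contraction_compose_bounded[OF this this] show ?thesis by (simp add: C(2))
qed

lemma positive_op_square:
  assumes Y: "hermitian Y"
  shows "positive_op (\<lambda>x. Y (Y x))"
proof -
  obtain k where k: "k > 0" "bounded_by k Y"
    using bounded_linear_bounded_by[OF hermitian_bounded_linear[OF Y]] .
  define Z where "Z x = (1 / k) *\<^sub>R Y x" for x
  have "hermitian Z" unfolding Z_def using Y by (rule hermitian_scaleR)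
  moreover have "bounded_by 1 Z"
    using k by (simp add: bounded_by_def Z_def divide_simps mult.commute)
  ultimately have "positive_op (\<lambda>x. Z (Z x))"
    using contraction_one_minus_square[of Z] hermitian_compose[of Z Z]
    by (intro positive_opI[of _ 1]) auto
  then have "positive_op (\<lambda>x. k\<^sup>2 *\<^sub>R Z (Z x))"
    by (rule positive_op_scaleR) simp
  then show ?thesis
    using k(1) by (simp add: Z_def hermitian_algebra[OF Y] power2_eq_square)
qed

text \<open>The product is the square of the hermitian operator \<open>\<surd>X \<surd>Y\<close>.\<close>

lemma positive_op_compose:
  assumes X: "positive_op X" and Y: "positive_op Y" and XY: "\<And>x. X (Y x) = Y (X x)"
  shows "positive_op (\<lambda>x. X (Y x))"
proof -
  note hermX = positive_op_hermitian[OF X] and hermY = positive_op_hermitian[OF Y]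
  obtain C where C: "positive_op C" "\<And>x. C (C x) = X x"
    "\<And>D x. hermitian D \<Longrightarrow> (\<And>y. D (X y) = X (D y)) \<Longrightarrow> D (C x) = C (D x)"
    using positive_op_sqrt[OF X] by blast
  obtain D where D: "positive_op D" "\<And>x. D (D x) = Y x"
    "\<And>E x. hermitian E \<Longrightarrow> (\<And>y. E (Y y) = Y (E y)) \<Longrightarrow> E (D x) = D (E x)"
    using positive_op_sqrt[OF Y] by blast
  note herm = positive_op_hermitian[OF C(1)] positive_op_hermitian[OF D(1)]
  have "C (Y x) = Y (C x)" for x
    by (rule C(3)[OF hermY, symmetric]) (simp add: XY)
  then have CD: "C (D x) = D (C x)" for x
    by (rule D(3)[OF herm(1)])
  have "hermitian (\<lambda>x. C (D x))"
    by (rule hermitian_compose[OF herm CD])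
  then have "positive_op (\<lambda>x. C (D (C (D x))))"
    by (rule positive_op_square)
  moreover have "C (D (C (D x))) = X (Y x)" for x
    by (metis CD C(2) D(2))
  ultimately show ?thesis by simp
qed

text \<open>With square roots \<open>C\<close> of \<open>X\<close> and \<open>D\<close> of \<open>Y\<close>, the hypothesis \<open>C\<^sup>2 + D\<^sup>2 = 0\<close> makes the normal
  operators \<open>C \<plusminus> i D\<close> vanish.\<close>

lemma positive_op_antisym:
  assumes X: "positive_op X" and Y: "positive_op Y" and "\<And>x. X x + Y x = 0"
  shows "X x = 0"
proof -
  have YX: "Y x = - X x" for x using assms(3)[of x] by (simp add: eq_neg_iff_add_eq_0 add.commute)
  note hermX = positive_op_hermitian[OF X]
  obtain C where C: "positive_op C" "\<And>x. C (C x) = X x"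
    "\<And>D x. hermitian D \<Longrightarrow> (\<And>y. D (X y) = X (D y)) \<Longrightarrow> D (C x) = C (D x)"
    using positive_op_sqrt[OF X] by blast
  obtain D where D: "positive_op D" "\<And>x. D (D x) = Y x"
    "\<And>E x. hermitian E \<Longrightarrow> (\<And>y. E (Y y) = Y (E y)) \<Longrightarrow> E (D x) = D (E x)"
    using positive_op_sqrt[OF Y] by blast
  note herm = positive_op_hermitian[OF C(1)] positive_op_hermitian[OF D(1)]
  have "C (X x) = X (C x)" for x
    by (metis C(2))
  then have "C (Y x) = Y (C x)" for x
    by (simp add: YX hermitian_algebra[OF herm(1)])
  then have CD: "C (D x) = D (C x)" for x
    by (rule D(3)[OF herm(1)])
  have null: "C x + c *\<^sub>C D x = 0" if c: "cnj c = - c" "c * c = -1" for c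
  proof -
    have "ip (C x + c *\<^sub>C D x) (C x + c *\<^sub>C D x) = 0"
      unfolding ip_normal_combination[OF herm CD c] C(2) D(2) assms(3) by simp
    then show ?thesis by simp
  qed
  have "(C x + \<i> *\<^sub>C D x) + (C x + (- \<i>) *\<^sub>C D x) = 2 *\<^sub>R C x"
    by (simp add: scaleR_2 scaleC_minus_left)
  moreover have "C x + \<i> *\<^sub>C D x = 0" "C x + (- \<i>) *\<^sub>C D x = 0"
    by (simp_all add: null)
  ultimately have "C x = 0" by simp
  then show ?thesis using C(2)[of x] by (simp add: hermitian_algebra[OF herm(1)])
qed

lemma hermitian_square_eq_0:
  assumes D: "hermitian D" and "D (D x) = 0" shows "D x = 0"
proof -
  have "ip (D x) (D x) = 0" by (simp add: hermitianD[OF D] assms(2))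
  then show ?thesis by simp
qed

text \<open>Write \<open>D = S - R\<close>. Both \<open>D\<^sup>2 S\<close> and \<open>D\<^sup>2 R\<close> are positive and their sum is
  \<open>D (S\<^sup>2 - R\<^sup>2) = 0\<close>, so they vanish, and with them their difference \<open>D\<^sup>3\<close>.\<close>

lemma commuting_positive_sqrt_unique:
  assumes S: "positive_op S" and R: "positive_op R" and comm: "\<And>x. S (R x) = R (S x)"
    and eq: "\<And>x. S (S x) = R (R x)"
  shows "S x = R x"
proof -
  note hermS = positive_op_hermitian[OF S] and hermR = positive_op_hermitian[OF R]
  define D where "D x = S x - R x" for x
  have D: "hermitian D" unfolding D_def by (rule hermitian_diff[OF hermS hermR])
  note lin = hermitian_algebra[OF hermS] hermitian_algebra[OF hermR]
  have DD: "positive_op (\<lambda>x. D (D x))" by (rule positive_op_square[OF D])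
  have DS: "positive_op (\<lambda>x. D (D (S x)))"
    by (rule positive_op_compose[OF DD S]) (simp add: D_def lin comm)
  have DR: "positive_op (\<lambda>x. D (D (R x)))"
    by (rule positive_op_compose[OF DD R]) (simp add: D_def lin comm)
  have zero: "D (D (S y)) + D (D (R y)) = 0" for y
    by (simp add: D_def lin comm eq)
  have "D (D (S y)) = 0" for y
    by (rule positive_op_antisym[OF DS DR zero])
  moreover have "D (D (R y)) = 0" for y
    by (rule positive_op_antisym[OF DR DS]) (metis zero add.commute)
  ultimately have "D (D (D x)) = 0"
    by (simp add: D_def[of x] hermitian_algebra[OF D])
  then have "D x = 0" using hermitian_square_eq_0[OF D] by blast
  then show ?thesis by (simp add: D_def)
qed

text \<open>The root \<open>C\<close> of \<open>positive_op_sqrt\<close> commutes with every root of the same operator, since a root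
  commutes with its square. So the commuting case identifies both \<open>S\<close> and \<open>R\<close> with \<open>C\<close>.\<close>

lemma positive_sqrt_unique:
  assumes S: "positive_op S" and R: "positive_op R" and eq: "\<And>x. S (S x) = R (R x)"
  shows "S = R"
proof -
  obtain C where C: "positive_op C" "\<And>x. C (C x) = S (S x)"
    "\<And>D x. hermitian D \<Longrightarrow> (\<And>y. D (S (S y)) = S (S (D y))) \<Longrightarrow> D (C x) = C (D x)"
    using positive_op_sqrt[OF positive_op_square[OF positive_op_hermitian[OF S]]] by blast
  have "S x = C x" for x
    by (rule commuting_positive_sqrt_unique[OF S C(1)])
      (simp_all add: C(2) C(3)[OF positive_op_hermitian[OF S]])
  moreover have "R x = C x" for x
    by (rule commuting_positive_sqrt_unique[OF R C(1)])
      (simp_all add: C(2) C(3)[OF positive_op_hermitian[OF R]] eq)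
  ultimately show ?thesis by auto
qed

text \<open>After division by \<open>\<surd>k\<close>, the square roots of \<open>X\<close> and of \<open>k - X\<close> have squares that add up to
  \<open>1\<close>, so they are contractions.\<close>

lemma positive_op_bounded_by:
  assumes X: "positive_op X" and Y: "positive_op (\<lambda>x. k *\<^sub>R x - X x)" and "k > 0"
  shows "bounded_by k X"
proof -
  note hermX = positive_op_hermitian[OF X]
  obtain C where C: "positive_op C" "\<And>x. C (C x) = X x"
    "\<And>D x. hermitian D \<Longrightarrow> (\<And>y. D (X y) = X (D y)) \<Longrightarrow> D (C x) = C (D x)"
    using positive_op_sqrt[OF X] by blast
  obtain E where E: "positive_op E" "\<And>x. E (E x) = k *\<^sub>R x - X x"
    "\<And>D x. hermitian D \<Longrightarrow> (\<And>y. D (k *\<^sub>R y - X y) = k *\<^sub>R D y - X (D y)) \<Longrightarrow> D (E x) = E (D x)"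
    using positive_op_sqrt[OF Y] by blast
  note herm = positive_op_hermitian[OF C(1)] positive_op_hermitian[OF E(1)]
  have "C (X x) = X (C x)" for x by (metis C(2))
  then have CE: "C (E x) = E (C x)" for x
    by (intro E(3)[OF herm(1)]) (simp add: hermitian_algebra[OF herm(1)])
  define r where "r = 1 / sqrt k"
  have r: "r * r = 1 / k" "r * (r * k) = 1" using \<open>k > 0\<close> by (simp_all add: r_def)
  have rC: "bounded_by 1 (\<lambda>x. r *\<^sub>R C x)"
  proof (rule contraction_of_sum_of_squares)
    show "hermitian (\<lambda>x. r *\<^sub>R C x)" "hermitian (\<lambda>x. r *\<^sub>R E x)"
      by (rule hermitian_scaleR, rule herm)+
    show "r *\<^sub>R C (r *\<^sub>R E x) = r *\<^sub>R E (r *\<^sub>R C x)" for x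
      by (simp add: hermitian_algebra[OF herm(1)] hermitian_algebra[OF herm(2)] CE)
    show "r *\<^sub>R C (r *\<^sub>R C x) + r *\<^sub>R E (r *\<^sub>R E x) = x" for x
      using \<open>k > 0\<close>
      by (simp add: hermitian_algebra[OF herm(1)] hermitian_algebra[OF herm(2)] C(2) E(2) r
          scaleR_diff_right)
  qed
  have "r *\<^sub>R C (r *\<^sub>R C x) = (1 / k) *\<^sub>R X x" for x
    by (simp add: hermitian_algebra[OF herm(1)] C(2) r(1))
  with contraction_compose_bounded[OF rC rC] show ?thesis
    using \<open>k > 0\<close> by (simp add: bounded_by_def divide_simps mult.commute[of _ k])
qed

lemma positive_op_le_bounded_by:
  assumes X: "positive_op X" and Y: "positive_op Y"
    and XY: "bounded_by k (\<lambda>x. X x + Y x)" and "k > 0"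
  shows "bounded_by k X"
proof (rule positive_op_bounded_by[OF X _ \<open>k > 0\<close>])
  have "positive_op (\<lambda>x. k *\<^sub>R x - (X x + Y x))"
    using positive_op_hermitian[OF positive_op_add[OF X Y]] XY \<open>k > 0\<close>
    by (intro positive_op_shift) auto
  from positive_op_add[OF this Y] show "positive_op (\<lambda>x. k *\<^sub>R x - X x)"
    by simp
qed

section \<open>Positivity and the spectrum\<close>

lemma hermitian_right_inverse_left:
  assumes "hermitian T" "\<And>x. T (R x) = x"
  shows "R (T x) = x"
proof (rule ip_eqI)
  fix z
  have "ip (R (T x)) z = ip (T x) (R z)"
    by (rule hermitianD[OF hermitian_inverse[OF assms]])
  then show "ip (R (T x)) z = ip x z"
    by (simp add: hermitianD[OF assms(1)] assms(2))
qed

text \<open>The inverse of \<open>X + e\<close> is the fixed point of the contraction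
  \<open>u \<mapsto> (y + t u - X u) / (t + e)\<close>, where \<open>norm (t - X) \<le> t\<close>.\<close>

lemma positive_op_add_scalar_invertible:
  assumes X: "positive_op X" and "e > 0"
  obtains R where "hermitian R" "\<And>x. X (R x) + e *\<^sub>R R x = x" "\<And>x. R (X x + e *\<^sub>R x) = x"
proof -
  note hermX = positive_op_hermitian[OF X]
  obtain t where t: "t > 0" "bounded_by t (\<lambda>x. t *\<^sub>R x - X x)"
    using X by (rule positive_op_witness)
  have "\<exists>u. X u + e *\<^sub>R u = y" for y
  proof -
    define f where "f u = (1 / (t + e)) *\<^sub>R (y + t *\<^sub>R u - X u)" for u
    have "dist (f u) (f v) \<le> t / (t + e) * dist u v" for u v
    proof -
      have "f u - f v = (1 / (t + e)) *\<^sub>R (t *\<^sub>R (u - v) - X (u - v))"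
        by (simp add: f_def hermitian_algebra[OF hermX] algebra_simps)
      then show ?thesis
        using bounded_byD[OF t(2), of "u - v"] t(1) \<open>e > 0\<close>
        by (simp add: dist_norm divide_simps)
    qed
    then obtain u where u: "f u = u"
      using banach_fix_type[of "t / (t + e)" f] t(1) \<open>e > 0\<close> by (auto simp: divide_simps)
    have "(t + e) *\<^sub>R u = y + t *\<^sub>R u - X u"
      using t(1) \<open>e > 0\<close> by (subst u[symmetric]) (simp add: f_def)
    then show ?thesis by (intro exI[of _ u]) (simp add: algebra_simps)
  qed
  then obtain R where R: "\<And>y. X (R y) + e *\<^sub>R R y = y" by metis
  have hermT: "hermitian (\<lambda>x. X x + e *\<^sub>R x)"
    by (intro hermitian_add hermitian_scaleR hermitian_id hermX)
  show thesis
    by (rule that[OF hermitian_inverse[OF hermT R] R hermitian_right_inverse_left[OF hermT R]])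
qed

text \<open>The inverse \<open>R\<close> of \<open>Y + d/4\<close> satisfies \<open>R \<le> 2/d\<close>; multiplying \<open>2/d - R\<close> by
  \<open>Y + d/4\<close> shows \<open>Y + d/4 \<ge> d/2\<close>.\<close>

lemma positive_op_gap:
  assumes Y: "positive_op Y" and "d > 0" and below: "\<And>x. d * norm x \<le> norm (Y x)"
  shows "positive_op (\<lambda>x. Y x - (d / 4) *\<^sub>R x)"
proof -
  obtain R where R: "hermitian R" "\<And>x. Y (R x) + (d / 4) *\<^sub>R R x = x"
      "\<And>x. R (Y x + (d / 4) *\<^sub>R x) = x"
    using positive_op_add_scalar_invertible[OF Y, of "d / 4"] \<open>d > 0\<close> by auto
  define T where "T x = Y x + (d / 4) *\<^sub>R x" for x
  have T: "positive_op T"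
    unfolding T_def using \<open>d > 0\<close> by (intro positive_op_add Y positive_op_scaleR_id) simp
  have "norm (R x) \<le> (2 / d) * norm x" for x
  proof -
    have "norm (Y (R x)) \<le> norm x + (d / 4) * norm (R x)"
      using norm_triangle_ineq4[of x "(d / 4) *\<^sub>R R x"] \<open>d > 0\<close>
      by (simp add: eq_diff_eq[THEN iffD2, OF R(2)])
    moreover have "0 \<le> (d / 4) * norm (R x)" using \<open>d > 0\<close> by simp
    ultimately have "(d / 2) * norm (R x) \<le> norm x"
      using below[of "R x"] by simp
    then show ?thesis using \<open>d > 0\<close> by (simp add: field_simps)
  qed
  then have Q: "positive_op (\<lambda>x. (2 / d) *\<^sub>R x - R x)"
    using R(1) \<open>d > 0\<close> by (intro positive_op_shift) (auto simp: bounded_by_def)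
  have TR: "T (R x) = x" "R (T x) = x" for x
    using R(2,3) by (simp_all add: T_def)
  note lin = hermitian_algebra[OF positive_op_hermitian[OF T]]
  have "positive_op (\<lambda>x. T ((2 / d) *\<^sub>R x - R x))"
    by (rule positive_op_compose[OF T Q]) (simp add: lin TR)
  then have "positive_op (\<lambda>x. (d / 2) *\<^sub>R T ((2 / d) *\<^sub>R x - R x))"
    by (rule positive_op_scaleR) (use \<open>d > 0\<close> in simp)
  moreover have "(d / 2) *\<^sub>R T ((2 / d) *\<^sub>R x - R x) = Y x - (d / 4) *\<^sub>R x" for x
  proof -
    have "(d / 2) *\<^sub>R T ((2 / d) *\<^sub>R x - R x) = T x - (d / 2) *\<^sub>R x"
      using \<open>d > 0\<close> by (simp add: lin TR scaleR_diff_right)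
    also have "\<dots> = Y x - (d / 2 - d / 4) *\<^sub>R x"
      unfolding T_def scaleR_diff_left by simp
    finally show ?thesis by simp
  qed
  ultimately show ?thesis by simp
qed

text \<open>Both \<open>X + s\<close> and \<open>k + 1 - (X + s)\<close> are positive for small \<open>s\<close>, where \<open>k\<close> bounds \<open>X\<close>. So the
  norm condition holds with the same constant \<open>k + 1\<close> for all of them and passes to the limit.\<close>

lemma positive_op_limit:
  assumes X: "hermitian X" and pos: "\<And>s. s > 0 \<Longrightarrow> positive_op (\<lambda>x. X x + s *\<^sub>R x)"
  shows "positive_op X"
proof -
  obtain k where k: "k > 0" "bounded_by k X"
    using bounded_linear_bounded_by[OF hermitian_bounded_linear[OF X]] .
  let ?t = "k + 1"
  have "norm (?t *\<^sub>R x - (X x + s *\<^sub>R x)) \<le> ?t * norm x" if "0 < s" "s < 1" for s x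
  proof -
    note Xs = pos[OF that(1)]
    have "norm (X y + s *\<^sub>R y) \<le> ?t * norm y" for y
    proof -
      have "norm (X y + s *\<^sub>R y) \<le> k * norm y + s * norm y"
        using bounded_byD[OF k(2), of y] that by (intro norm_triangle_mono) auto
      also have "\<dots> \<le> ?t * norm y"
        using that mult_right_mono[of s 1 "norm y"] by (simp add: distrib_right)
      finally show ?thesis .
    qed
    then have "positive_op (\<lambda>x. ?t *\<^sub>R x - (X x + s *\<^sub>R x))"
      using k(1) positive_op_hermitian[OF Xs] by (intro positive_op_shift) (auto simp: bounded_by_def)
    then have "bounded_by ?t (\<lambda>x. ?t *\<^sub>R x - (X x + s *\<^sub>R x))"
      by (rule positive_op_bounded_by) (use Xs k(1) in \<open>simp_all add: add.commute\<close>)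
    then show ?thesis by (rule bounded_byD)
  qed
  note bound = this
  have "norm (?t *\<^sub>R x - X x) \<le> ?t * norm x" for x
  proof (rule tendsto_upperbound)
    have "((\<lambda>s. norm (?t *\<^sub>R x - (X x + s *\<^sub>R x))) \<longlongrightarrow> norm (?t *\<^sub>R x - (X x + 0 *\<^sub>R x)))
        (at_right (0::real))"
      by (intro tendsto_intros)
    then show "((\<lambda>s. norm (?t *\<^sub>R x - (X x + s *\<^sub>R x))) \<longlongrightarrow> norm (?t *\<^sub>R x - X x))
        (at_right (0::real))"
      by simp
    show "\<forall>\<^sub>F s in at_right (0::real). norm (?t *\<^sub>R x - (X x + s *\<^sub>R x)) \<le> ?t * norm x"
      using bound by (auto intro!: eventually_at_rightI[of 0 1])
  qed simp
  then show ?thesis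
    using X k(1) by (intro positive_opI[of _ ?t]) (auto simp: bounded_by_def)
qed

text \<open>If the infimum \<open>m\<close> of all \<open>s \<ge> 0\<close> with \<open>X + s \<ge> 0\<close> were positive, then the gap
  below \<open>X + m\<close> would allow a smaller \<open>s\<close>.\<close>

lemma positive_op_of_bounded_below:
  assumes X: "hermitian X"
    and below: "\<And>s. s > 0 \<Longrightarrow> \<exists>d>0. \<forall>x. d * norm x \<le> norm (X x + s *\<^sub>R x)"
  shows "positive_op X"
proof (rule positive_op_limit[OF X])
  define A where "A = {s. s \<ge> 0 \<and> positive_op (\<lambda>x. X x + s *\<^sub>R x)}"
  define m where "m = Inf A"
  have A_bdd: "bdd_below A" by (auto simp: A_def bdd_below_def)
  obtain k where k: "k > 0" "bounded_by k X"
    using bounded_linear_bounded_by[OF hermitian_bounded_linear[OF X]] .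
  have "positive_op (\<lambda>x. k *\<^sub>R x - - X x)"
    by (rule positive_op_shift)
      (use k hermitian_scaleR[OF X, of "-1"] in \<open>auto simp: bounded_by_def\<close>)
  then have "k \<in> A" using k(1) by (simp add: A_def add.commute)
  then have A_ne: "A \<noteq> {}" by auto
  have "m \<ge> 0" unfolding m_def by (rule cInf_greatest[OF A_ne]) (simp add: A_def)
  have "m = 0"
  proof (rule ccontr)
    assume "m \<noteq> 0"
    with \<open>m \<ge> 0\<close> have "m > 0" by simp
    obtain d where d: "d > 0" "\<And>x. d * norm x \<le> norm (X x + m *\<^sub>R x)"
      using below[OF \<open>m > 0\<close>] by blast
    \<comment> \<open>\<open>X + s\<close> below is within \<open>e\<close> of \<open>X + m\<close>, so it is bounded below by \<open>7 e\<close>; the resulting gap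
      \<open>7 e / 4\<close> exceeds \<open>e\<close> and does not exceed \<open>m\<close>.\<close>
    define e where "e = min d m / 8"
    have e: "e > 0" "8 * e \<le> d" "8 * e \<le> m" using d(1) \<open>m > 0\<close> by (auto simp: e_def)
    obtain s where s: "s \<in> A" "s < m + e"
      using cInf_lessD[OF A_ne, of "m + e"] e(1) by (auto simp: m_def)
    have "m \<le> s" unfolding m_def by (rule cInf_lower[OF s(1) A_bdd])
    have "(7 * e) * norm x \<le> norm (X x + s *\<^sub>R x)" for x
    proof -
      have "8 * e * norm x \<le> norm (X x + m *\<^sub>R x)"
        using d(2)[of x] mult_right_mono[OF e(2), of "norm x"] by simp
      also have "X x + m *\<^sub>R x = (X x + s *\<^sub>R x) - (s - m) *\<^sub>R x"
        by (simp add: algebra_simps)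
      also have "norm \<dots> \<le> norm (X x + s *\<^sub>R x) + (s - m) * norm x"
        using norm_triangle_ineq4[of "X x + s *\<^sub>R x" "(s - m) *\<^sub>R x"] \<open>m \<le> s\<close> by simp
      also have "(s - m) * norm x \<le> e * norm x"
        using s(2) by (intro mult_right_mono) auto
      finally show ?thesis by (simp add: algebra_simps)
    qed
    then have "positive_op (\<lambda>x. (X x + s *\<^sub>R x) - (7 * e / 4) *\<^sub>R x)"
      using s(1) e(1) by (intro positive_op_gap) (auto simp: A_def)
    then have "positive_op (\<lambda>x. X x + (s - 7 * e / 4) *\<^sub>R x)"
      by (simp add: algebra_simps)
    then have "s - 7 * e / 4 \<in> A"
      using e \<open>m \<le> s\<close> by (simp add: A_def)
    then have "m \<le> s - 7 * e / 4" unfolding m_def by (rule cInf_lower[OF _ A_bdd])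
    then show False using s(2) e(1) by simp
  qed
  fix s :: real assume "s > 0"
  then obtain r where r: "r \<in> A" "r < s"
    using cInf_lessD[OF A_ne, of s] \<open>m = 0\<close> by (auto simp: m_def)
  then have "positive_op (\<lambda>x. (X x + r *\<^sub>R x) + (s - r) *\<^sub>R x)"
    using positive_op_add[OF _ positive_op_scaleR_id[of "s - r"]] by (auto simp: A_def)
  then show "positive_op (\<lambda>x. X x + s *\<^sub>R x)"
    by (simp add: algebra_simps)
qed

text \<open>For negative \<open>\<zeta>\<close> this is invertibility of \<open>X\<close> plus a positive number. For \<open>\<zeta> = r + i b\<close> with \<open>b \<noteq> 0\<close> put
  \<open>Y = X - r\<close>; then \<open>(i b - Y) (- i b - Y) = Y\<^sup>2 + b\<^sup>2\<close>, which is invertible because \<open>Y\<^sup>2\<close> is positive.\<close>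

lemma positive_op_resolvent:
  assumes X: "positive_op X" and \<zeta>: "\<zeta> \<notin> \<real>\<^sub>\<ge>\<^sub>0"
  shows "\<exists>S\<in>adjointables ip. (\<forall>x. \<zeta> *\<^sub>C S x - X (S x) = x) \<and> (\<forall>x. S (\<zeta> *\<^sub>C x - X x) = x)"
proof (cases "Im \<zeta> = 0")
  case True
  then have "Re \<zeta> < 0" using \<zeta> by (simp add: complex_nonneg_Reals_iff)
  define e where "e = - Re \<zeta>"
  have "e > 0" using \<open>Re \<zeta> < 0\<close> by (simp add: e_def)
  have \<zeta>_eq: "\<zeta> *\<^sub>C x = - (e *\<^sub>R x)" for x :: 'h
  proof -
    have "\<zeta> = complex_of_real (- e)" using True by (simp add: e_def complex_eq_iff)
    then show ?thesis using scaleR_scaleC[of "- e" x] by simp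
  qed
  obtain R where R: "hermitian R" "\<And>x. X (R x) + e *\<^sub>R R x = x" "\<And>x. R (X x + e *\<^sub>R x) = x"
    using positive_op_add_scalar_invertible[OF X \<open>e > 0\<close>] by blast
  define S where "S x = - R x" for x
  have "hermitian S"
    unfolding S_def using hermitian_scaleR[OF R(1), of "-1"] by simp
  then have "S \<in> adjointables ip"
    by (auto simp: adjointables_def hermitian_iff_is_adjoint)
  moreover have "\<zeta> *\<^sub>C S x - X (S x) = x" for x
    using R(2)[of x]
    by (simp add: S_def \<zeta>_eq hermitian_algebra[OF positive_op_hermitian[OF X]] add.commute)
  moreover have "S (\<zeta> *\<^sub>C x - X x) = x" for x
  proof -
    have "\<zeta> *\<^sub>C x - X x = - (X x + e *\<^sub>R x)" by (simp add: \<zeta>_eq)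
    then show ?thesis by (simp only: S_def hermitian_algebra(3)[OF R(1)] R(3) minus_minus)
  qed
  ultimately show ?thesis by blast
next
  case False
  define b where "b = Im \<zeta>"
  define c where "c = \<i> * complex_of_real b"
  define Y where "Y x = X x - Re \<zeta> *\<^sub>R x" for x
  have Y: "hermitian Y"
    unfolding Y_def
    by (intro hermitian_diff hermitian_scaleR hermitian_id positive_op_hermitian[OF X])
  have \<zeta>_eq: "\<zeta> *\<^sub>C x - X x = c *\<^sub>C x - Y x" for x
  proof -
    have "\<zeta> = complex_of_real (Re \<zeta>) + c" by (simp add: c_def b_def complex_eq_iff)
    then have "\<zeta> *\<^sub>C x = Re \<zeta> *\<^sub>R x + c *\<^sub>C x"
      by (metis scaleC_add_left scaleR_scaleC)
    then show ?thesis by (simp add: Y_def)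
  qed
  obtain R where R: "hermitian R" "\<And>x. Y (Y (R x)) + b\<^sup>2 *\<^sub>R R x = x"
    "\<And>x. R (Y (Y x) + b\<^sup>2 *\<^sub>R x) = x"
    using positive_op_add_scalar_invertible[OF positive_op_square[OF Y], of "b\<^sup>2"] False
    by (auto simp: b_def)
  note lin = hermitian_algebra[OF Y] hermitian_algebra[OF R(1)]
  have RY: "R (Y x) = Y (R x)" for x
  proof -
    have "R (Y (Y (Y (R x)) + b\<^sup>2 *\<^sub>R R x)) = Y (R x)"
      using R(3)[of "Y (R x)"] by (simp add: lin)
    then show ?thesis by (simp only: R(2))
  qed
  have cc: "c *\<^sub>C c *\<^sub>C x = - (b\<^sup>2 *\<^sub>R x)" for x :: 'h
  proof -
    have "c * c = complex_of_real (- (b\<^sup>2))"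
      by (simp add: c_def power2_eq_square complex_eq_iff)
    then show ?thesis using scaleR_scaleC[of "- (b\<^sup>2)" x] by (simp add: scaleC_scaleC)
  qed
  define S where "S x = - (c *\<^sub>C R x) - Y (R x)" for x
  have cnj_c: "cnj c = - c" by (simp add: c_def)
  have "is_adjoint ip S (\<lambda>x. c *\<^sub>C R x - R (Y x))"
    unfolding is_adjoint_def S_def
    by (simp add: ip_algebra ip_scaleC_left ip_scaleC_right cnj_c hermitianD[OF Y]
        hermitianD[OF R(1)] scaleC_minus_left[symmetric])
  then have "S \<in> adjointables ip" by (auto simp: adjointables_def)
  moreover have "\<zeta> *\<^sub>C S x - X (S x) = x" for x
    using R(2)[of x] unfolding \<zeta>_eq by (simp add: S_def lin cc scaleC_diff_right add.commute)
  moreover have "S (\<zeta> *\<^sub>C x - X x) = x" for x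
    using R(3)[of x] unfolding \<zeta>_eq by (simp add: S_def lin RY cc scaleC_diff_right add.commute)
  ultimately show ?thesis by blast
qed

lemma positives_iff_positive_op: "X \<in> positives ip \<longleftrightarrow> positive_op X"
proof
  assume X: "positive_op X"
  have "\<zeta> \<in> \<real>\<^sub>\<ge>\<^sub>0" if "\<zeta> \<in> op_spectrum ip X" for \<zeta>
  proof (rule ccontr)
    assume "\<zeta> \<notin> \<real>\<^sub>\<ge>\<^sub>0"
    from positive_op_resolvent[OF X this] show False
      using that by (auto simp: op_spectrum_def fun_eq_iff)
  qed
  then show "X \<in> positives ip"
    using positive_op_hermitian[OF X] by (auto simp: positives_def self_adjoints_iff_hermitian)
next
  assume X: "X \<in> positives ip"
  then have hermX: "hermitian X" by (simp add: positives_def self_adjoints_iff_hermitian)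
  then show "positive_op X"
  proof (rule positive_op_of_bounded_below)
    fix s :: real assume "s > 0"
    have "complex_of_real (- s) \<notin> op_spectrum ip X"
      using X \<open>s > 0\<close> unfolding positives_def
      by (metis (no_types, lifting) mem_Collect_eq subsetD nonneg_Reals_of_real_iff
          neg_0_le_iff_le not_le)
    then obtain S where S: "S \<in> adjointables ip" "S \<circ> (\<lambda>x. complex_of_real (- s) *\<^sub>C x - X x) = id"
      by (auto simp: op_spectrum_def)
    then obtain k where k: "k > 0" "bounded_by k S"
      by (auto simp: adjointables_def intro: bounded_linear_bounded_by is_adjoint_bounded_linear)
    have "(1 / k) * norm x \<le> norm (X x + s *\<^sub>R x)" for x
    proof -
      have "S (- (s *\<^sub>R x) - X x) = x"
        using fun_cong[OF S(2), of x] scaleR_scaleC[of "- s" x] by simp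
      then have "norm x \<le> k * norm (- (s *\<^sub>R x) - X x)"
        using bounded_byD[OF k(2)] by metis
      also have "norm (- (s *\<^sub>R x) - X x) = norm (X x + s *\<^sub>R x)"
        by (metis norm_minus_commute diff_minus_eq_add minus_diff_commute)
      finally show ?thesis using k(1) by (simp add: field_simps)
    qed
    then show "\<exists>d>0. \<forall>x. d * norm x \<le> norm (X x + s *\<^sub>R x)"
      using k(1) by (intro exI[of _ "1 / k"]) auto
  qed
qed

end

section \<open>The algebra acting on itself\<close>

lemma cstar_inner_space_algebra: "cstar_inner_space (\<lambda>a b::'a::cstar_algebra. star a * b)"
proof
  fix a b :: 'a
  show "norm (star a * b) \<le> norm a * norm b"
    using norm_mult_ineq[of "star a" b] by simp
qed (simp_all add: distrib_left mult_scaleC_right star_mult star_star cstar_identity)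

text \<open>Through left multiplications, positivity of operators becomes a tool for the algebra itself.\<close>

interpretation algebra: cstar_inner_space "\<lambda>a b::'a::cstar_algebra. star a * b"
  by (rule cstar_inner_space_algebra)

text \<open>A left inverse \<open>b + \<mu>\<close> of \<open>- (a + s)\<close> in the unitization bounds left multiplication by
  \<open>a + s\<close> from below by \<open>1 / (norm b + cmod \<mu>)\<close>.\<close>

lemma cstar_positive_positive_op:
  fixes a :: "'a::cstar_algebra"
  assumes "cstar_positive a"
  shows "algebra.positive_op (\<lambda>x. a * x)"
proof (rule algebra.positive_op_of_bounded_below)
  have a: "star a = a" using assms by (simp add: cstar_positive_def)
  then show "algebra.hermitian (\<lambda>x. a * x)"
    by (simp add: algebra.hermitian_def star_mult mult.assoc)
  fix s :: real assume "s > 0"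
  have "complex_of_real (- s) \<notin> cstar_spectrum a"
    using assms \<open>s > 0\<close> unfolding cstar_positive_def
    by (metis subsetD nonneg_Reals_of_real_iff neg_0_le_iff_le not_le)
  then obtain u where "unitization_mult u (- a, complex_of_real (- s)) = (0, 1)"
    by (auto simp: cstar_spectrum_def)
  moreover obtain b \<mu> where "u = (b, \<mu>)" by fastforce
  ultimately have u: "b * (- a) + \<mu> *\<^sub>C (- a) + complex_of_real (- s) *\<^sub>C b = 0"
    "\<mu> * complex_of_real (- s) = 1" by auto
  have "- (b * a + \<mu> *\<^sub>C a + s *\<^sub>R b) = 0"
    using u(1) unfolding scaleR_scaleC[symmetric] by simp
  then have b: "b * a + \<mu> *\<^sub>C a + s *\<^sub>R b = 0" by (simp only: neg_equal_0_iff_equal)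
  have \<mu>: "s *\<^sub>R \<mu> *\<^sub>C x = - x" for x :: 'a
  proof -
    have "complex_of_real s * \<mu> = complex_of_real (- 1)"
      using u(2) by (simp add: mult.commute minus_equation_iff)
    then show ?thesis
      unfolding scaleR_scaleC[of s] scaleC_scaleC using scaleR_scaleC[of "- 1" x] by simp
  qed
  define k where "k = norm b + cmod \<mu>"
  have "cmod \<mu> > 0" using u(2) by auto
  then have "k > 0" by (simp add: k_def add_nonneg_pos)
  have "(1 / k) * norm x \<le> norm (a * x + s *\<^sub>R x)" for x
  proof -
    let ?y = "a * x + s *\<^sub>R x"
    have "b * ?y + \<mu> *\<^sub>C ?y = (b * a + \<mu> *\<^sub>C a + s *\<^sub>R b) * x + s *\<^sub>R \<mu> *\<^sub>C x"
      by (simp add: distrib_left distrib_right mult.assoc scaleC_add_right mult_scaleC_left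
          scaleC_scaleR mult_scaleR_left mult_scaleR_right)
    also have "\<dots> = - x" by (simp add: b \<mu>)
    finally have "norm x = norm (b * ?y + \<mu> *\<^sub>C ?y)" by simp
    also have "\<dots> \<le> norm b * norm ?y + cmod \<mu> * norm ?y"
      by (intro norm_triangle_mono norm_mult_ineq) (simp add: norm_scaleC)
    finally show ?thesis using \<open>k > 0\<close> by (simp add: k_def field_simps)
  qed
  then show "\<exists>d>0. \<forall>x. d * norm x \<le> norm (a * x + s *\<^sub>R x)"
    using \<open>k > 0\<close> by (intro exI[of _ "1 / k"]) auto
qed

text \<open>A bound for left multiplication by \<open>a\<close> bounds \<open>norm a\<close>, as \<open>norm (a * star a) = (norm a)\<^sup>2\<close>.\<close>

lemma norm_le_of_positive_op_add:
  fixes a b :: "'a::cstar_algebra"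
  assumes a: "algebra.positive_op (\<lambda>x. a * x)" and b: "algebra.positive_op (\<lambda>x. b * x)"
  shows "norm a \<le> norm (a + b)"
proof (rule field_le_epsilon)
  fix e :: real assume "e > 0"
  have "norm ((a + b) * x) \<le> (norm (a + b) + e) * norm x" for x
  proof -
    have "0 \<le> e * norm x" using \<open>e > 0\<close> by simp
    then show ?thesis
      using norm_mult_ineq[of "a + b" x] unfolding distrib_right[of "norm (a + b)"] by linarith
  qed
  then have "bounded_by (norm (a + b) + e) (\<lambda>x. a * x + b * x)"
    by (simp add: bounded_by_def distrib_right)
  from algebra.positive_op_le_bounded_by[OF a b this] \<open>e > 0\<close>
  have "bounded_by (norm (a + b) + e) (\<lambda>x. a * x)" by (simp add: add_nonneg_pos)
  from bounded_byD[OF this, of "star a"]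
  have "norm a * norm a \<le> (norm (a + b) + e) * norm a"
    using cstar_identity[of "star a"] by (simp add: star_star power2_eq_square)
  then show "norm a \<le> norm (a + b) + e"
    using \<open>e > 0\<close> by (cases "norm a = 0") auto
qed

section \<open>Hilbert modules\<close>

context hilbert_module
begin

lemma norm_ip_self_eq: "norm (ip x x) = (norm x)\<^sup>2"
  by (simp add: norm_eq)

lemma ip_act_left: "ip (act x a) y = star a * ip x y"
  by (metis ip_act_right star_mult star_ip)

lemma norm_act_le: "norm (act x a) \<le> norm x * norm a"
proof -
  have "(norm (act x a))\<^sup>2 = norm (star a * (ip x x * a))"
    by (simp add: norm_ip_self_eq[symmetric] ip_act_left ip_act_right mult.assoc)
  also have "\<dots> \<le> norm (star a) * norm (ip x x * a)" by (rule norm_mult_ineq)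
  also have "\<dots> \<le> norm a * (norm (ip x x) * norm a)"
    by (simp add: mult_left_mono norm_mult_ineq)
  also have "\<dots> = (norm x * norm a)\<^sup>2" by (simp add: norm_ip_self_eq power2_eq_square)
  finally show ?thesis by (simp add: power2_le_iff_abs_le)
qed

text \<open>Cauchy-Schwarz. Put \<open>a = \<langle>x, y\<rangle>\<close> and assume first that \<open>a\<close> is self-adjoint. For
  \<open>norm x = 1\<close> and \<open>z = x a - y\<close>,
  \<open>\<langle>z, z\<rangle> + 2 a\<^sup>2 = \<langle>x a, x a\<rangle> + \<langle>y, y\<rangle>\<close>, and both terms on the left are positive, so
  \<open>2 (norm a)\<^sup>2 \<le> (norm a)\<^sup>2 + (norm y)\<^sup>2\<close>. Self-adjointness makes \<open>a\<^sup>2\<close> the square of a hermitian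
  operator; this is why the argument does not presuppose that
  \<open>star a * a\<close> is positive in general. The general case is the
  self-adjoint one for the pair \<open>x\<close>, \<open>y a*\<close>, whose inner product is \<open>a a*\<close>.\<close>

lemma cstar_inner_space_module: "cstar_inner_space ip"
proof
  note norm_self = norm_ip_self_eq
  have ip_add_left: "ip (x + y) z = ip x z + ip y z" for x y z
    by (metis ip_add_right star_add star_ip)
  have scaleR_right: "ip x (r *\<^sub>R y) = r *\<^sub>R ip x y" for x y r
    by (simp add: scaleR_scaleC ip_scaleC_right)
  have scaleR_left: "ip (r *\<^sub>R x) y = r *\<^sub>R ip x y" for x y r
    using scaleR_right[of y r x] by (metis scaleR_scaleC ip_scaleC_right star_ip star_scaleC complex_cnj_complex_of_real)
  have ip_diff_right: "ip x (y - z) = ip x y - ip x z" for x y z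
    using ip_add_right[of x "y - z" z] by (simp add: eq_diff_eq)
  have ip_diff_left: "ip (x - y) z = ip x z - ip y z" for x y z
    by (metis ip_diff_right star_diff star_ip)
  have sa: "norm (ip x y) \<le> norm x * norm y" if a: "star (ip x y) = ip x y" for x y
  proof (cases "ip x y = 0")
    case False
    define a where "a = ip x y"
    define n where "n = norm x"
    have yx: "ip y x = a" using a by (metis a_def star_ip)
    have "star a = a" using a by (simp add: a_def)
    \<comment> \<open>The factor \<open>n\<^sup>2\<close> replaces the normalization of \<open>x\<close>.\<close>
    define z where "z = act x a - n\<^sup>2 *\<^sub>R y"
    have z: "2 *\<^sub>R (n\<^sup>2 *\<^sub>R (a * a)) + ip z z = ip (act x a) (act x a) + (n^4) *\<^sub>R ip y y"
      unfolding z_def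
      by (simp add: ip_diff_left ip_diff_right ip_act_left ip_act_right \<open>star a = a\<close> yx a_def[symmetric]
          scaleR_right scaleR_left power4_eq_xxxx power2_eq_square algebra_simps
          scaleR_add_left[symmetric])
    have "algebra.positive_op (\<lambda>x. a * (a * x))"
      by (rule algebra.positive_op_square) (simp add: algebra.hermitian_def star_mult mult.assoc \<open>star a = a\<close>)
    then have "algebra.positive_op (\<lambda>x. (2 * n\<^sup>2) *\<^sub>R (a * (a * x)))"
      by (rule algebra.positive_op_scaleR) simp
    then have sq: "algebra.positive_op (\<lambda>x. (2 *\<^sub>R (n\<^sup>2 *\<^sub>R (a * a))) * x)"
      by (simp add: mult.assoc)
    have "norm (2 *\<^sub>R (n\<^sup>2 *\<^sub>R (a * a))) \<le> norm (ip (act x a) (act x a) + (n^4) *\<^sub>R ip y y)"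
      using norm_le_of_positive_op_add[OF sq cstar_positive_positive_op[OF ip_positive[of z]]]
      by (simp only: z)
    also have "\<dots> \<le> norm (ip (act x a) (act x a)) + norm ((n^4) *\<^sub>R ip y y)"
      by (rule norm_triangle_ineq)
    also have "\<dots> \<le> (n * norm a)\<^sup>2 + n^4 * (norm y)\<^sup>2"
      using power_mono[OF norm_act_le[of x a], of 2] by (simp add: norm_self n_def)
    also have "norm (2 *\<^sub>R (n\<^sup>2 *\<^sub>R (a * a))) = 2 * n\<^sup>2 * (norm a)\<^sup>2"
      using cstar_identity[of a] by (simp add: \<open>star a = a\<close>)
    finally have le: "n\<^sup>2 * (norm a)\<^sup>2 \<le> n\<^sup>2 * (n * norm y)\<^sup>2"
      by (simp add: power_mult_distrib power4_eq_xxxx power2_eq_square mult.assoc mult.left_commute)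
    have "n \<noteq> 0"
    proof
      assume "n = 0"
      then have "x + x = x" by (simp add: n_def)
      then have "ip x y = 0" using ip_add_left[of x x y] by simp
      then show False using False by simp
    qed
    then have "(norm a)\<^sup>2 \<le> (n * norm y)\<^sup>2" using le by simp
    then show ?thesis by (simp add: a_def n_def power2_le_iff_abs_le)
  qed simp
  show "norm (ip x y) \<le> norm x * norm y" for x y
  proof (cases "ip x y = 0")
    case False
    let ?a = "ip x y"
    have "(norm ?a)\<^sup>2 = norm (ip x (act y (star ?a)))"
      using cstar_identity[of "star ?a"] by (simp add: ip_act_right star_star)
    also have "\<dots> \<le> norm x * norm (act y (star ?a))"
      by (rule sa) (simp add: ip_act_right star_mult star_star)
    also have "\<dots> \<le> norm x * (norm y * norm ?a)"
      using norm_act_le[of y "star ?a"] by (intro mult_left_mono) auto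
    finally show ?thesis using False by (simp add: power2_eq_square)
  qed simp
qed (simp_all add: ip_add_right ip_scaleC_right star_ip norm_ip_self_eq)

sublocale cstar_inner_space ip
  by (rule cstar_inner_space_module)

lemma norm_ip_le_add: "norm (ip x x) \<le> norm (ip x x + ip y y)"
  by (intro norm_le_of_positive_op_add cstar_positive_positive_op ip_positive)

text \<open>Since \<open>\<langle>x, (T*T + s) x\<rangle> = \<langle>Tx, Tx\<rangle> + s \<langle>x, x\<rangle>\<close> dominates \<open>s \<langle>x, x\<rangle>\<close>, the operator
  \<open>T*T + s\<close> is bounded below by \<open>s\<close>.\<close>

lemma positive_op_adjoint_compose:
  assumes T: "is_adjoint ip T S"
  shows "positive_op (\<lambda>x. S (T x))"
proof (rule positive_op_of_bounded_below)
  have ST: "ip x (S y) = ip (T x) y" "ip (S x) y = ip x (T y)" for x y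
    using T is_adjoint_sym[OF T] by (simp_all add: is_adjoint_def)
  show "hermitian (\<lambda>x. S (T x))" by (simp add: hermitian_def ST)
  fix s :: real assume "s > 0"
  have "s * norm x \<le> norm (S (T x) + s *\<^sub>R x)" for x
  proof (cases "x = 0")
    case False
    define y where "y = sqrt s *\<^sub>R x"
    have yy: "ip y y = s *\<^sub>R ip x x" using \<open>s > 0\<close> by (simp add: y_def ip_algebra)
    have "s * (norm x)\<^sup>2 = norm (ip y y)" using \<open>s > 0\<close> by (simp add: yy norm_ip_self)
    also have "\<dots> \<le> norm (ip y y + ip (T x) (T x))" by (rule norm_ip_le_add)
    also have "ip y y + ip (T x) (T x) = ip x (S (T x) + s *\<^sub>R x)"
      by (simp add: yy ip_algebra ST)
    also have "norm \<dots> \<le> norm x * norm (S (T x) + s *\<^sub>R x)" by (rule norm_ip_le)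
    finally show ?thesis using False by (simp add: power2_eq_square)
  qed simp
  then show "\<exists>d>0. \<forall>x. d * norm x \<le> norm (S (T x) + s *\<^sub>R x)"
    using \<open>s > 0\<close> by blast
qed

lemma op_sqrt_eqI:
  assumes "positive_op R" "\<And>x. R (R x) = X x"
  shows "op_sqrt ip X = R"
  unfolding op_sqrt_def
proof (rule the_equality)
  show "R \<in> positives ip \<and> R \<circ> R = X"
    using assms by (auto simp: positives_iff_positive_op)
  fix S assume "S \<in> positives ip \<and> S \<circ> S = X"
  then show "S = R"
    using assms by (intro positive_sqrt_unique) (auto simp: positives_iff_positive_op)
qed

lemma op_abs_positive_square:
  assumes "is_adjoint ip T S"
  shows "positive_op (op_abs ip T)" "op_abs ip T (op_abs ip T x) = S (T x)"
proof -
  obtain R where R: "positive_op R" "\<And>x. R (R x) = S (T x)"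
    by (rule positive_op_sqrt[OF positive_op_adjoint_compose[OF assms]]) (rule that)
  have "op_abs ip T = R"
    unfolding op_abs_def adj_eqI[OF assms] by (rule op_sqrt_eqI) (simp_all add: R)
  then show "positive_op (op_abs ip T)" "op_abs ip T (op_abs ip T x) = S (T x)"
    using R by auto
qed

section \<open>Orthogonal projections\<close>

lemma proj_onto_eqI:
  assumes "M \<inter> perp ip M = {0}" "closed_submodule act M" "y \<in> M" "x - y \<in> perp ip M"
  shows "proj_onto ip M x = y"
  unfolding proj_onto_def
proof (rule the_equality)
  show "y \<in> M \<and> x - y \<in> perp ip M" using assms by simp
  fix z assume z: "z \<in> M \<and> x - z \<in> perp ip M"
  have "y + (- 1) *\<^sub>C z \<in> M"
    using assms(2,3) z by (simp add: closed_submodule_def)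
  then have "y - z \<in> M" by (simp add: scaleC_minus_left)
  moreover have "y - z \<in> perp ip M"
  proof -
    have "ip (y - z) w = ip (x - z) w - ip (x - y) w" for w
      by (simp add: ip_algebra)
    then show ?thesis using z assms(4) by (simp add: perp_def)
  qed
  ultimately have "y - z \<in> M \<inter> perp ip M" by (rule IntI)
  then show "z = y" unfolding assms(1) by simp
qed

lemma orthogonally_complemented_proj:
  assumes M: "orthogonally_complemented act ip M"
  shows proj_onto_mem: "proj_onto ip M x \<in> M"
    and proj_onto_perp: "y \<in> M \<Longrightarrow> ip (x - proj_onto ip M x) y = 0"
proof -
  obtain u v where uv: "u \<in> M" "v \<in> perp ip M" "x = u + v"
    using M unfolding orthogonally_complemented_def by meson
  then have "proj_onto ip M x = u"
    using M by (intro proj_onto_eqI) (auto simp: orthogonally_complemented_def)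
  then show "proj_onto ip M x \<in> M" "y \<in> M \<Longrightarrow> ip (x - proj_onto ip M x) y = 0"
    using uv by (auto simp: perp_def)
qed

lemma proj_onto_hermitian:
  assumes M: "orthogonally_complemented act ip M"
  shows "hermitian (proj_onto ip M)"
proof (rule hermitianI)
  fix x y
  let ?P = "proj_onto ip M"
  have "ip (?P x) y = ip (?P x) (?P y)"
    using arg_cong[OF proj_onto_perp[OF M proj_onto_mem[OF M, of x], of y], of star]
    by (simp add: star_ip ip_algebra star_diff)
  also have "\<dots> = ip x (?P y)"
    using proj_onto_perp[OF M proj_onto_mem[OF M, of y], of x] by (simp add: ip_algebra)
  finally show "ip (?P x) y = ip x (?P y)" .
qed

lemma proj_onto_fixed:
  assumes M: "orthogonally_complemented act ip M" and "x \<in> M"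
  shows "proj_onto ip M x = x"
  using assms by (intro proj_onto_eqI) (auto simp: orthogonally_complemented_def perp_def)

lemma perp_closure_range:
  assumes "\<And>y. ip x (T y) = 0"
  shows "x \<in> perp ip (closure (range T))"
proof -
  have "closed {y. ip x y = 0}"
    by (intro closed_Collect_eq continuous_intros
        bounded_linear.continuous_on[OF bounded_linear_ip_right])
  moreover have "range T \<subseteq> {y. ip x y = 0}" using assms by auto
  ultimately have "closure (range T) \<subseteq> {y. ip x y = 0}" by (rule closure_minimal[rotated])
  then show ?thesis by (auto simp: perp_def)
qed

lemma bounded_linear_closure_image:
  assumes "bounded_linear D" "x \<in> closure S" "\<And>y. y \<in> S \<Longrightarrow> D y \<in> closure U"
  shows "D x \<in> closure U"
proof -
  have "D ` closure S \<subseteq> closure U"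
    using assms
    by (intro image_closure_subset[of S D])
      (auto intro: bounded_linear.continuous_on[OF assms(1)] continuous_on_id)
  then show ?thesis using assms(2) by auto
qed

text \<open>\<open>D\<close> maps the range of \<open>T\<close> into itself because it commutes with \<open>T\<close>, and the orthogonal
  complement into itself because it is also hermitian.\<close>

lemma proj_onto_closure_range_commute:
  assumes T: "hermitian T" and D: "hermitian D" and comm: "\<And>x. D (T x) = T (D x)"
    and M: "orthogonally_complemented act ip (closure (range T))"
  shows "proj_onto ip (closure (range T)) (D x) = D (proj_onto ip (closure (range T)) x)"
proof (rule proj_onto_eqI)
  let ?M = "closure (range T)" and ?P = "proj_onto ip (closure (range T))"
  show "?M \<inter> perp ip ?M = {0}" "closed_submodule act ?M"
    using M by (auto simp: orthogonally_complemented_def)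
  show "D (?P x) \<in> ?M"
    by (rule bounded_linear_closure_image[OF hermitian_bounded_linear[OF D] proj_onto_mem[OF M]])
      (use comm closure_subset[of "range T"] in auto)
  have "ip (D x - D (?P x)) (T y) = 0" for y
  proof -
    have "ip (D x - D (?P x)) (T y) = ip (x - ?P x) (T (D y))"
      by (simp add: ip_algebra hermitianD[OF D] comm)
    also have "\<dots> = 0"
      by (rule proj_onto_perp[OF M]) (use closure_subset[of "range T"] in auto)
    finally show ?thesis .
  qed
  then show "D x - D (?P x) \<in> perp ip ?M" by (rule perp_closure_range)
qed

text \<open>The closure is convex as the closure of a linear image, and closed under scalars by
  continuity; sums are obtained as \<open>x + y = 2 (x/2 + y/2)\<close>.\<close>

lemma closed_submodule_closure_range:
  assumes T: "is_adjoint ip T S"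
  shows "closed_submodule act (closure (range T))"
proof -
  let ?M = "closure (range T)"
  note TS = T[unfolded is_adjoint_def, rule_format]
  note lin = bounded_linear.linear[OF is_adjoint_bounded_linear[OF T]]
  have zero: "0 \<in> ?M"
    using linear_0[OF lin] closure_subset[of "range T"] by (metis UNIV_I image_eqI subsetD)
  have scale: "c *\<^sub>C x \<in> ?M" if "x \<in> ?M" for c x
  proof (rule bounded_linear_closure_image[OF _ that])
    show "bounded_linear (\<lambda>x::'h. c *\<^sub>C x)"
      by (rule bounded_linear_intro[of _ "cmod c"])
        (simp_all add: scaleC_add_right scaleC_scaleR norm_scaleC_vec mult.commute)
    show "c *\<^sub>C y \<in> ?M" if "y \<in> range T" for y
      using that is_adjoint_scaleC[OF T, of c, symmetric] closure_subset[of "range T"] by auto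
  qed
  have add: "x + y \<in> ?M" if "x \<in> ?M" "y \<in> ?M" for x y
  proof -
    have "convex ?M" by (intro convex_closure convex_linear_image[OF lin] convex_UNIV)
    then have "(1 / 2) *\<^sub>R x + (1 / 2) *\<^sub>R y \<in> ?M" using that by (intro convexD) auto
    from scale[OF this, of "complex_of_real 2"] show ?thesis
      by (simp only: scaleR_scaleC[symmetric]) (simp add: scaleR_add_right)
  qed
  have act: "act x a \<in> ?M" if "x \<in> ?M" for a x
  proof (rule bounded_linear_closure_image[OF _ that])
    show "bounded_linear (\<lambda>x. act x a)"
      by (rule bounded_linear_intro[of _ "norm a"])
        (simp_all add: act_add_left scaleR_scaleC act_scaleC_left norm_act_le)
    have "act (T y) a = T (act y a)" for y
      by (rule ip_eqI) (simp add: TS ip_act_left)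
    then show "act y a \<in> ?M" if "y \<in> range T" for y
      using that closure_subset[of "range T"] by auto
  qed
  show ?thesis
    using zero add scale act by (simp add: closed_submodule_def)
qed

section \<open>The polar decomposition of a product\<close>

text \<open>Here \<open>A B\<close> is positive, so it is its own absolute value by uniqueness of positive roots. By
  \<open>proj_onto_closure_range_commute\<close> the two projections commute with \<open>A\<close>, with \<open>B\<close> and with each
  other, so their product \<open>U\<close> is the projection onto the closure of the range of \<open>A B\<close>.\<close>

lemma polar_decomposition_commuting_positives:
  assumes A: "positive_op A" and B: "positive_op B" and AB: "\<And>x. A (B x) = B (A x)"
    and MA: "orthogonally_complemented act ip (closure (range A))"
    and MB: "orthogonally_complemented act ip (closure (range B))"
  shows "polar_decomposition act ip (A \<circ> B)
    (proj_onto ip (closure (range A)) \<circ> proj_onto ip (closure (range B)))"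
proof -
  let ?P = "proj_onto ip (closure (range A))" and ?Q = "proj_onto ip (closure (range B))"
  let ?T = "A \<circ> B" and ?U = "?P \<circ> ?Q"
  let ?N = "closure (range ?T)"
  note hermA = positive_op_hermitian[OF A] and hermB = positive_op_hermitian[OF B]
  note hermP = proj_onto_hermitian[OF MA] and hermQ = proj_onto_hermitian[OF MB]
  have in_closure: "T x \<in> closure (range T)" for T :: "'h \<Rightarrow> 'h" and x
    using closure_subset[of "range T"] by auto
  have QA: "?Q (A x) = A (?Q x)" for x
    by (rule proj_onto_closure_range_commute[OF hermB hermA AB MB])
  have PB: "?P (B x) = B (?P x)" for x
    by (rule proj_onto_closure_range_commute[OF hermA hermB AB[symmetric] MA])
  have PQ: "?P (?Q x) = ?Q (?P x)" for x
    by (rule proj_onto_closure_range_commute[OF hermA hermQ QA MA])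
  have fixed: "?P (A x) = A x" "?Q (B x) = B x" for x
    by (rule proj_onto_fixed, fact, rule in_closure)+
  have idem: "?P (?P x) = ?P x" "?Q (?Q x) = ?Q x" for x
    by (rule proj_onto_fixed, fact, rule proj_onto_mem, fact)+
  have T: "positive_op ?T" using positive_op_compose[OF A B AB] by (simp add: comp_def)
  have hermU: "hermitian ?U" using hermitian_compose[OF hermP hermQ PQ] by (simp add: comp_def)
  have adjT: "adj ip ?T = ?T" and adjU: "adj ip ?U = ?U"
    using positive_op_hermitian[OF T] hermU by (simp_all add: adj_eqI hermitian_iff_is_adjoint)
  have UU: "?U \<circ> ?U = ?U" by (auto simp: PQ idem)
  have absT: "op_abs ip ?T = ?T"
    unfolding op_abs_def adjT by (rule op_sqrt_eqI[OF T]) simp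
  have UT: "?U (?T x) = ?T x" for x
    by (simp add: QA fixed)
  have sub: "closed_submodule act ?N"
    using positive_op_hermitian[OF T]
    by (intro closed_submodule_closure_range[of _ ?T]) (simp add: hermitian_iff_is_adjoint)
  have U_mem: "?U x \<in> ?N" for x
  proof -
    have "?Q (A y) \<in> ?N" for y
      unfolding QA
      by (rule bounded_linear_closure_image[OF hermitian_bounded_linear[OF hermA] proj_onto_mem[OF MB]])
        (use in_closure[of ?T] in auto)
    then have "?Q (?P x) \<in> ?N"
      by (intro bounded_linear_closure_image[OF hermitian_bounded_linear[OF hermQ] proj_onto_mem[OF MA]])
        auto
    then show ?thesis by (simp add: PQ)
  qed
  have U_perp: "x - ?U x \<in> perp ip ?N" for x
  proof (rule perp_closure_range)
    fix y
    show "ip (x - ?U x) (?T y) = 0"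
      by (simp only: ip_diff_left hermitianD[OF hermU] UT) simp
  qed
  have disjoint: "?N \<inter> perp ip ?N = {0}"
    using sub by (auto simp: closed_submodule_def perp_def)
  have compl: "orthogonally_complemented act ip ?N"
    unfolding orthogonally_complemented_def
    using sub disjoint U_mem U_perp by (metis add.commute diff_add_cancel)
  have proj: "proj_onto ip ?N = ?U"
    by (rule ext, rule proj_onto_eqI[OF disjoint sub U_mem U_perp])
  have "?U \<in> self_adjoints ip" by (simp only: self_adjoints_iff_hermitian hermU)
  then have "partial_isometry ip ?U"
    by (simp only: partial_isometry_def adjU UU projections_def) (simp add: self_adjoints_def UU)
  moreover have "?T = ?U \<circ> ?T" using UT by auto
  ultimately show ?thesis
    unfolding polar_decomposition_def adjT adjU absT UU using compl proj by auto
qed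

text \<open>The hypothesis says that \<open>q p q\<close>, which is \<open>(p q)* (p q)\<close>, is idempotent. It makes
  \<open>p q - q p q\<close> vanish, as \<open>(p q - q p q)* (p q - q p q) = q p q - q p q p q\<close>. So \<open>p q = q p q\<close> is
  self-adjoint.\<close>

lemma partial_isometry_projections_commute:
  assumes p: "hermitian p" "\<And>x. p (p x) = p x" and q: "hermitian q" "\<And>x. q (q x) = q x"
    and idem: "\<And>x. q (p (q (p (q x)))) = q (p (q x))"
  shows "p (q x) = q (p x)"
proof -
  have qpq: "q (p (q y)) = p (q y)" for y
  proof -
    let ?z = "p (q y) - q (p (q y))"
    have "ip ?z ?z = ip y (q (p (q y)) - q (p (q (p (q y)))))"
      by (simp add: ip_algebra hermitianD[OF p(1)] hermitianD[OF q(1)] p(2) q(2))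
    then have "ip ?z ?z = 0" by (simp add: idem)
    then show ?thesis by simp
  qed
  show ?thesis
  proof (rule ip_eqI)
    fix z
    have "ip (p (q x)) z = ip (q (p (q x))) z" by (simp only: qpq)
    also have "\<dots> = ip x (q (p (q z)))" by (simp only: hermitianD[OF p(1)] hermitianD[OF q(1)])
    also have "\<dots> = ip (q (p x)) z" by (simp only: qpq hermitianD[OF p(1)] hermitianD[OF q(1)])
    finally show "ip (p (q x)) z = ip (q (p x)) z" .
  qed
qed

text \<open>Let \<open>T = A B\<close>. As \<open>p\<close> and \<open>q\<close> commute, \<open>p q\<close> equals \<open>(p q)* (p q)\<close>, the projection \<open>E\<close> onto
  the closure of the range of \<open>T*\<close>. Now \<open>E\<close> fixes \<open>|T|\<^sup>2 = T* T\<close> and therefore \<open>|T|\<close>, so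
  \<open>T = E |T| = |T|\<close> is self-adjoint, that is, \<open>A B = B A\<close>.\<close>

lemma commute_of_polar_decomposition_projections:
  assumes A: "hermitian A" and B: "hermitian B"
    and p: "p \<in> projections ip" and q: "q \<in> projections ip"
    and polar: "polar_decomposition act ip (A \<circ> B) (p \<circ> q)"
  shows "A \<circ> B = B \<circ> A"
proof -
  let ?T = "A \<circ> B" and ?U = "p \<circ> q" and ?M = "closure (range (B \<circ> A))"
  have T_adj: "is_adjoint ip ?T (B \<circ> A)"
    by (simp add: is_adjoint_def hermitianD[OF A] hermitianD[OF B])
  have p: "hermitian p" "p (p x) = p x" and q: "hermitian q" "q (q x) = q x" for x
    using p q by (auto simp: projections_def self_adjoints_iff_hermitian dest: fun_cong)
  have "is_adjoint ip ?U (q \<circ> p)"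
    by (simp add: is_adjoint_def hermitianD[OF p(1)] hermitianD[OF q(1)])
  then have "adj ip ?U = q \<circ> p" by (rule adj_eqI)
  then have M: "orthogonally_complemented act ip ?M"
    and UU_fun: "(q \<circ> p) \<circ> (p \<circ> q) = proj_onto ip ?M" and T_eq: "?T = ?U \<circ> op_abs ip ?T"
    using polar by (simp_all only: polar_decomposition_def adj_eqI[OF T_adj])
  have UU: "q (p (q x)) = proj_onto ip ?M x" for x
    using fun_cong[OF UU_fun, of x] by (simp only: o_apply p(2))
  have idem: "q (p (q (p (q x)))) = q (p (q x))" for x
    using proj_onto_fixed[OF M proj_onto_mem[OF M, of x]] unfolding UU[symmetric] q(2) .
  have pq: "p (q x) = q (p x)" for x
    by (rule partial_isometry_projections_commute[OF p q idem])
  define E where "E x = p (q x)" for x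
  have E: "E x = proj_onto ip ?M x" for x
    using UU[of x] by (simp add: E_def pq q(2))
  have hermE: "hermitian E"
    unfolding E_def by (rule hermitian_compose[OF p(1) q(1) pq])
  define R where "R = op_abs ip ?T"
  have R: "positive_op R" "R (R x) = B (A (A (B x)))" for x
    unfolding R_def using op_abs_positive_square[OF T_adj] by auto
  note hermR = positive_op_hermitian[OF R(1)]
  \<comment> \<open>\<open>R\<^sup>2 (1 - E)\<close> is the adjoint of \<open>(1 - E) R\<^sup>2 = 0\<close>, hence \<open>R (1 - E) = 0\<close>.\<close>
  have "E (R x) = R x" for x
  proof (rule ip_eqI)
    fix z
    have E_RR: "E (R (R y)) = R (R y)" for y
      unfolding E R(2) using closure_subset[of "range (B \<circ> A)"]
      by (intro proj_onto_fixed[OF M]) auto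
    let ?w = "z - E z"
    have "R (R ?w) = 0"
    proof (rule ip_eqI)
      fix v
      have "ip (R (R ?w)) v = ip z (R (R v)) - ip z (E (R (R v)))"
        by (simp only: hermitianD[OF hermR] ip_diff_left hermitianD[OF hermE])
      then show "ip (R (R ?w)) v = ip 0 v" by (simp add: E_RR)
    qed
    then have "R ?w = 0" by (rule hermitian_square_eq_0[OF hermR])
    then have "ip x (R ?w) = 0" by simp
    then have "ip (R x) z - ip (R x) (E z) = 0"
      by (simp only: hermitianD[OF hermR, symmetric] ip_diff_right)
    then show "ip (E (R x)) z = ip (R x) z" by (simp add: hermitianD[OF hermE])
  qed
  moreover have "A (B x) = E (R x)" for x
    using fun_cong[OF T_eq, of x] by (simp only: o_apply E_def R_def)
  ultimately have TR: "?T = R" by (simp add: fun_eq_iff)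
  have "is_adjoint ip ?T ?T" unfolding TR using hermR by (simp add: hermitian_iff_is_adjoint)
  from is_adjoint_unique[OF T_adj this] show ?thesis by (rule sym)
qed

end

theorem lemma3p3:
  fixes act :: "'h::{complex_vector, banach} \<Rightarrow> 'a::cstar_algebra \<Rightarrow> 'h"
    and ip :: "'h \<Rightarrow> 'h \<Rightarrow> 'a"
    and A B :: "'h \<Rightarrow> 'h"
  assumes "hilbert_module act ip"
    and "A \<in> adjointables ip" and "B \<in> adjointables ip"
    and "orthogonally_complemented act ip (closure (range A))"
    and "orthogonally_complemented act ip (closure (range B))"
  shows "(A \<in> positives ip \<and> B \<in> positives ip \<and> A \<circ> B = B \<circ> A \<longrightarrow>
            polar_decomposition act ip (A \<circ> B)
              (proj_onto ip (closure (range A)) \<circ> proj_onto ip (closure (range B))))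
       \<and> (A \<in> self_adjoints ip \<and> B \<in> self_adjoints ip
            \<and> (\<exists>p\<in>projections ip. \<exists>q\<in>projections ip.
                 polar_decomposition act ip (A \<circ> B) (p \<circ> q)) \<longrightarrow>
            A \<circ> B = B \<circ> A)"
proof -
  interpret hilbert_module act ip by (rule assms(1))
  have comm: "A (B x) = B (A x)" if "A \<circ> B = B \<circ> A" for x
    using fun_cong[OF that, of x] by simp
  show ?thesis
    unfolding positives_iff_positive_op self_adjoints_iff_hermitian
    using polar_decomposition_commuting_positives[OF _ _ comm assms(4,5)]
      commute_of_polar_decomposition_projections[of A B]
    by blast
qed

end
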